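(* There is a polynomial-time algorithm and a constant $c>0$ such that, for every instance $(G,X)$ of STAR in which $G$ is a grid graph with $n$ rows and $m$ columns, the algorithm outputs a cycle of $G$ covering $X$ of length at most $\left(\tfrac32 + c\left(\tfrac1n+\tfrac1m\right)\right)\left(\mathrm{OPT}+|E\setminus X|\right)$.
   Context: STAR: given a simple graph $G=(V,E)$ and non-empty $X\subseteq E$, find a minimum-length cycle, not necessarily simple (a closed walk, possibly a single vertex of length $0$; length counts edges with repetitions), covering $X$, i.e. every edge of $X$ has an endpoint among the cycle's vertices; $\mathrm{OPT}$ denotes this minimum length. A grid graph with $n$ rows and $m$ columns is $P_n\square P_m$. *)

theory Defs
  imports Complex_Main "HOL-Computational_Algebra.Polynomial"
begin

section \<open>Graphs\<close>

record 'a graph =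
  verts :: "'a set"
  edges :: "'a set set"

definition simple_graph :: "'a graph \<Rightarrow> bool" where
  "simple_graph G \<longleftrightarrow> finite (verts G) \<and>
     (\<forall>e\<in>edges G. \<exists>u\<in>verts G. \<exists>v\<in>verts G. u \<noteq> v \<and> e = {u, v})"

definition graph_iso :: "'a graph \<Rightarrow> 'b graph \<Rightarrow> bool" where
  "graph_iso G H \<longleftrightarrow>
     (\<exists>f. bij_betw f (verts G) (verts H) \<and> edges H = (\<lambda>e. f ` e) ` edges G)"

definition path_graph :: "nat \<Rightarrow> nat graph" where
  "path_graph n = \<lparr>verts = {..<n}, edges = {{i, Suc i} | i. Suc i < n}\<rparr>"

definition cartesian_product :: "'a graph \<Rightarrow> 'b graph \<Rightarrow> ('a \<times> 'b) graph" where
  "cartesian_product G H =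
     \<lparr>verts = verts G \<times> verts H,
      edges = {{(u, v), (u, v')} | u v v'. u \<in> verts G \<and> {v, v'} \<in> edges H}
            \<union> {{(u, v), (u', v)} | u u' v. {u, u'} \<in> edges G \<and> v \<in> verts H}\<rparr>"

text \<open>Grid graphs are understood up to isomorphism: the vertices of an input graph carry
  arbitrary labels, so its rows and columns are not part of the input.\<close>

definition grid_graph :: "nat \<Rightarrow> nat \<Rightarrow> 'a graph \<Rightarrow> bool" where
  "grid_graph n m G \<longleftrightarrow> n \<ge> 1 \<and> m \<ge> 1 \<and>
     graph_iso (cartesian_product (path_graph n) (path_graph m)) G"


section \<open>The problem STAR\<close>

text \<open>A closed walk is given by its vertex sequence, in which the first vertex is repeated at
  the end. The list \<open>[v]\<close> is the closed walk of length \<open>0\<close> at \<open>v\<close>.\<close>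

definition closed_walk :: "'a graph \<Rightarrow> 'a list \<Rightarrow> bool" where
  "closed_walk G p \<longleftrightarrow> p \<noteq> [] \<and> set p \<subseteq> verts G \<and> hd p = last p \<and>
     (\<forall>i. Suc i < length p \<longrightarrow> {p ! i, p ! Suc i} \<in> edges G)"

definition walk_length :: "'a list \<Rightarrow> nat" where
  "walk_length p = length p - 1"

definition covers :: "'a list \<Rightarrow> 'a set set \<Rightarrow> bool" where
  "covers p X \<longleftrightarrow> (\<forall>e\<in>X. \<exists>v\<in>set p. v \<in> e)"

definition star_instance :: "'a graph \<Rightarrow> 'a set set \<Rightarrow> bool" where
  "star_instance G X \<longleftrightarrow> simple_graph G \<and> X \<subseteq> edges G \<and> X \<noteq> {}"

text \<open>Meaningful only if some closed walk covers \<open>X\<close>, as is always the case if \<open>G\<close> is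
  connected.\<close>

definition OPT :: "'a graph \<Rightarrow> 'a set set \<Rightarrow> nat" where
  "OPT G X = (LEAST k. \<exists>p. closed_walk G p \<and> covers p X \<and> walk_length p = k)"


section \<open>Polynomial-time algorithms\<close>

text \<open>Algorithms are programs of the language WHILE of N. D. Jones (\<^emph>\<open>Computability and
  Complexity: From a Programming Perspective\<close>), with the conditional as an additional primitive.
  Values are binary trees. The running time is the number of operations performed. There is no
  primitive comparison of trees, so that trees can be stored with sharing and every operation takes
  constant time on pointers; in particular polynomial time agrees with polynomial time on Turing
  machines, for functions whose results have polynomial size.\<close>

datatype data = Atom | Dot data data

datatype expr = Var nat | Quote_Atom | Cons_Ex expr expr | Hd_Ex expr | Tl_Ex expr

datatype com =
    Assign nat expr
  | Seq com com
  | If_Com expr com com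
  | While expr com

type_synonym store = "nat \<Rightarrow> data"

fun hd_data :: "data \<Rightarrow> data" where
  "hd_data Atom = Atom"
| "hd_data (Dot a b) = a"

fun tl_data :: "data \<Rightarrow> data" where
  "tl_data Atom = Atom"
| "tl_data (Dot a b) = b"

primrec eval_expr :: "expr \<Rightarrow> store \<Rightarrow> data" where
  "eval_expr (Var x) s = s x"
| "eval_expr Quote_Atom s = Atom"
| "eval_expr (Cons_Ex e f) s = Dot (eval_expr e s) (eval_expr f s)"
| "eval_expr (Hd_Ex e) s = hd_data (eval_expr e s)"
| "eval_expr (Tl_Ex e) s = tl_data (eval_expr e s)"

primrec expr_time :: "expr \<Rightarrow> nat" where
  "expr_time (Var x) = 1"
| "expr_time Quote_Atom = 1"
| "expr_time (Cons_Ex e f) = expr_time e + expr_time f + 1"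
| "expr_time (Hd_Ex e) = expr_time e + 1"
| "expr_time (Tl_Ex e) = expr_time e + 1"

text \<open>\<open>exec c s t s'\<close>: started in store \<open>s\<close>, command \<open>c\<close> halts after \<open>t\<close> operations in store \<open>s'\<close>.
  A test succeeds if its value is not \<open>Atom\<close>.\<close>

inductive exec :: "com \<Rightarrow> store \<Rightarrow> nat \<Rightarrow> store \<Rightarrow> bool" where
  Assign: "exec (Assign x e) s (expr_time e + 1) (s(x := eval_expr e s))"
| Seq: "exec c s t s' \<Longrightarrow> exec d s' t' s'' \<Longrightarrow> exec (Seq c d) s (t + t') s''"
| IfTrue: "eval_expr e s \<noteq> Atom \<Longrightarrow> exec c s t s' \<Longrightarrow>
    exec (If_Com e c d) s (expr_time e + 1 + t) s'"
| IfFalse: "eval_expr e s = Atom \<Longrightarrow> exec d s t s' \<Longrightarrow>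
    exec (If_Com e c d) s (expr_time e + 1 + t) s'"
| WhileFalse: "eval_expr e s = Atom \<Longrightarrow> exec (While e c) s (expr_time e + 1) s"
| WhileTrue: "eval_expr e s \<noteq> Atom \<Longrightarrow> exec c s t s' \<Longrightarrow> exec (While e c) s' t' s'' \<Longrightarrow>
    exec (While e c) s (expr_time e + 1 + t + t') s''"

lemma exec_deterministic:
  "exec c s t s' \<Longrightarrow> exec c s u s'' \<Longrightarrow> u = t \<and> s'' = s'"
proof (induction arbitrary: u s'' rule: exec.induct)
  case (Assign x e s)
  then show ?case by (auto elim: exec.cases)
next
  case (Seq c s t s' d t' s'')
  from Seq.prems show ?case
    by (cases rule: exec.cases) (use Seq.IH in blast)+
next
  case (IfTrue e s c t s' d)
  from IfTrue.prems IfTrue.hyps(1) show ?case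
    by (cases rule: exec.cases) (use IfTrue.IH in blast)+
next
  case (IfFalse e s d t s' c)
  from IfFalse.prems IfFalse.hyps(1) show ?case
    by (cases rule: exec.cases) (use IfFalse.IH in blast)+
next
  case (WhileFalse e s c)
  from WhileFalse.prems WhileFalse.hyps show ?case
    by (cases rule: exec.cases) auto
next
  case (WhileTrue e s c t s' t' s'')
  from WhileTrue.prems WhileTrue.hyps(1) show ?case
    by (cases rule: exec.cases) (use WhileTrue.IH in blast)+
qed

text \<open>Input and output are passed in variable \<open>0\<close>; all other variables are initially \<open>Atom\<close>.\<close>

definition halts_in :: "com \<Rightarrow> data \<Rightarrow> nat \<Rightarrow> data \<Rightarrow> bool" where
  "halts_in P d t r \<longleftrightarrow> (\<exists>s. exec P ((\<lambda>_. Atom)(0 := d)) t s \<and> s 0 = r)"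

definition outputs :: "com \<Rightarrow> data \<Rightarrow> data \<Rightarrow> bool" where
  "outputs P d r \<longleftrightarrow> (\<exists>t. halts_in P d t r)"

text \<open>\<open>size d\<close> is the number of \<open>Dot\<close> nodes of \<open>d\<close>.\<close>

definition polynomial_time :: "com \<Rightarrow> bool" where
  "polynomial_time P \<longleftrightarrow>
     (\<exists>q :: nat poly. \<forall>d. \<exists>t r. halts_in P d t r \<and> t \<le> poly q (size d))"


section \<open>Encoding of instances and closed walks\<close>

text \<open>Vertex labels are natural numbers, encoded in binary, least significant bit first.\<close>

fun enc_nat :: "nat \<Rightarrow> data" where
  "enc_nat n = (if n = 0 then Atom
     else Dot (if even n then Atom else Dot Atom Atom) (enc_nat (n div 2)))"

declare enc_nat.simps [simp del]

primrec enc_list :: "('a \<Rightarrow> data) \<Rightarrow> 'a list \<Rightarrow> data" where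
  "enc_list f [] = Atom"
| "enc_list f (x # xs) = Dot (f x) (enc_list f xs)"

definition enc_walk :: "nat list \<Rightarrow> data" where
  "enc_walk p = enc_list enc_nat p"

lemma enc_nat_inject [simp]: "enc_nat a = enc_nat b \<longleftrightarrow> a = b"
proof (induction a arbitrary: b rule: less_induct)
  case (less a)
  show ?case
  proof (cases "a = 0 \<or> b = 0")
    case True
    then show ?thesis by (auto simp: enc_nat.simps[of a] enc_nat.simps[of b])
  next
    case False
    then have "enc_nat a = enc_nat b \<longleftrightarrow> (even a \<longleftrightarrow> even b) \<and> a div 2 = b div 2"
      using less.IH[of "a div 2" "b div 2"]
      by (simp add: enc_nat.simps[of a] enc_nat.simps[of b])
    also have "\<dots> \<longleftrightarrow> a = b"
      by (metis even_two_times_div_two odd_two_times_div_two_succ)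
    finally show ?thesis .
  qed
qed

lemma enc_walk_inject [simp]: "enc_walk p = enc_walk q \<longleftrightarrow> p = q"
  unfolding enc_walk_def
proof (induction p arbitrary: q)
  case Nil
  then show ?case by (cases q) auto
next
  case (Cons a p)
  then show ?case by (cases q) auto
qed

text \<open>An instance is presented by listing the vertices, the edges and the edges of \<open>X\<close>, each once,
  in any order; each edge is a pair of its endpoints, in either order.\<close>

definition lists_edges :: "(nat \<times> nat) list \<Rightarrow> nat set set \<Rightarrow> bool" where
  "lists_edges es E \<longleftrightarrow>
     distinct (map (\<lambda>(u, v). {u, v}) es) \<and> set (map (\<lambda>(u, v). {u, v}) es) = E"

definition enc_edges :: "(nat \<times> nat) list \<Rightarrow> data" where
  "enc_edges = enc_list (\<lambda>(u, v). Dot (enc_nat u) (enc_nat v))"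

definition encodes_instance :: "data \<Rightarrow> nat graph \<Rightarrow> nat set set \<Rightarrow> bool" where
  "encodes_instance d G X \<longleftrightarrow>
     (\<exists>vs es xs. distinct vs \<and> set vs = verts G \<and>
        lists_edges es (edges G) \<and> lists_edges xs X \<and>
        d = Dot (enc_list enc_nat vs) (Dot (enc_edges es) (enc_edges xs)))"

end

theory Submission
  imports Defs
begin

text \<open>A closed walk of length \<open>l\<close> covers at most \<open>3 * l + 4\<close> edges, because consecutive vertices share an edge
  and degrees are at most \<open>4\<close>. Hence \<open>3 * (OPT + |E - X|) \<ge> 3 * |E| - 2 * |X| - 4 \<ge> |E| - 4\<close>, and \<open>|E|\<close> is
  about \<open>2 * n * m\<close>. So it suffices to visit all vertices by a closed walk of length
  \<open>n * m + O(n + m)\<close>, except when a single vertex covers \<open>X\<close> and the lower bound may vanish.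

  Such a walk is found in an unlabelled grid as follows. From the current vertex go to an
  unvisited neighbour, preferring one with another visited neighbour, then one of degree at most
  \<open>3\<close>. Started along a side at a corner, this follows the side and then snakes through the
  remaining columns one by one. To return, always go to the neighbour that was visited first; this
  leads along a row back to the first column and then to the corner. All edges are tried as
  starting edges, failed attempts are repaired by detours, and the shortest result is kept.\<close>

section \<open>Functions computable in polynomial time\<close>

text \<open>The factor 3/2 is the quotient of \<open>n * m\<close> by the lower bound, which is
  about \<open>2 * n * m / 3\<close>; everything linear in \<open>n + m\<close> is absorbed by the
  term with \<open>c\<close>. The coordinates are hidden, so the greedy rule has to tell columns
  apart locally: contact with another visited vertex singles out the continuation of a column, and
  degree at most 3 singles out the side while nothing but the side has been visited. These tests are
  shown to decide correctly for \<open>n, m \<ge> 3\<close>. If \<open>n \<le> 2\<close> or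
  \<open>m \<le> 2\<close>, then \<open>1/n + 1/m \<ge> 1/2\<close> and a crude linear bound on the
  output suffices; the constant 66 comes from this case. Polynomial time is obtained from closure
  properties. Every loop is a fold over a list that is already at hand, so a single
  \<open>While\<close> has to be analysed. Tests can only compare with \<open>Atom\<close>, and
  sharing lets trees grow much faster than time passes, so equality of labels needs its own loop and
  output sizes are bounded along with running times.\<close>

definition poly_bounded :: "(data \<Rightarrow> nat) \<Rightarrow> bool" where
  "poly_bounded g \<longleftrightarrow> (\<exists>k. \<forall>d. g d \<le> (size d + 2) ^ k)"

lemma poly_bounded_mono:
  "poly_bounded g \<Longrightarrow> (\<And>d. h d \<le> g d) \<Longrightarrow> poly_bounded h"
  unfolding poly_bounded_def by (meson le_trans)

lemma poly_bounded_const: "poly_bounded (\<lambda>_. c)"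
proof -
  have "c \<le> (size d + 2) ^ c" for d :: data
  proof -
    have "c \<le> 2 ^ c" by (simp add: less_imp_le)
    also have "\<dots> \<le> (size d + 2) ^ c" by (rule power_mono) auto
    finally show ?thesis .
  qed
  then show ?thesis unfolding poly_bounded_def by blast
qed

lemma poly_bounded_size: "poly_bounded size"
  unfolding poly_bounded_def by (rule exI[of _ 1]) simp

lemma poly_bounded_mult:
  assumes "poly_bounded g" "poly_bounded h"
  shows "poly_bounded (\<lambda>d. g d * h d)"
proof -
  obtain a b where "\<And>d. g d \<le> (size d + 2) ^ a" "\<And>d. h d \<le> (size d + 2) ^ b"
    using assms unfolding poly_bounded_def by blast
  then have "g d * h d \<le> (size d + 2) ^ (a + b)" for d
    by (simp add: power_add mult_le_mono)
  then show ?thesis unfolding poly_bounded_def by blast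
qed

text \<open>The base \<open>size d + 2\<close> is at least 2, so adding 1 raises the exponent by at
  most 1. The inequality \<open>g + h \<le> (g + 1) * (h + 1)\<close> then reduces sums to
  products.\<close>

lemma poly_bounded_add:
  assumes "poly_bounded g" "poly_bounded h"
  shows "poly_bounded (\<lambda>d. g d + h d)"
proof -
  have "poly_bounded (\<lambda>d. (g d + 1) * (h d + 1))"
    if "poly_bounded (\<lambda>d. g d + 1)" "poly_bounded (\<lambda>d. h d + 1)"
    using that by (rule poly_bounded_mult)
  moreover have "poly_bounded (\<lambda>d. f d + 1)" if f: "poly_bounded f" for f :: "data \<Rightarrow> nat"
  proof -
    obtain a where a: "\<And>d. f d \<le> (size d + 2) ^ a"
      using f unfolding poly_bounded_def by blast
    have "f d + 1 \<le> (size d + 2) ^ (a + 1)" for d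
    proof -
      have "1 \<le> (size d + 2) ^ a" by simp
      then have "f d + 1 \<le> (size d + 2) ^ a * 2" using a[of d] by linarith
      also have "\<dots> \<le> (size d + 2) ^ a * (size d + 2)" by (rule mult_le_mono2) simp
      finally show ?thesis by (simp add: mult.commute)
    qed
    then show ?thesis unfolding poly_bounded_def by blast
  qed
  ultimately have "poly_bounded (\<lambda>d. (g d + 1) * (h d + 1))" using assms by blast
  then show ?thesis by (rule poly_bounded_mono) simp
qed

lemma poly_bounded_compose:
  assumes "poly_bounded g" "poly_bounded (\<lambda>d. size (f d))"
  shows "poly_bounded (\<lambda>d. g (f d))"
proof -
  obtain a where a: "\<And>d. g d \<le> (size d + 2) ^ a"
    using assms unfolding poly_bounded_def by blast
  have "poly_bounded (\<lambda>d. size (f d) + 2)"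
    using assms by (intro poly_bounded_add poly_bounded_const)
  then obtain b where b: "\<And>d. size (f d) + 2 \<le> (size d + 2) ^ b"
    unfolding poly_bounded_def by blast
  have "g (f d) \<le> (size d + 2) ^ (b * a)" for d
    using a[of "f d"] power_mono[OF b[of d], of a] by (simp add: power_mult)
  then show ?thesis unfolding poly_bounded_def by blast
qed

text \<open>\<open>C k\<close> takes its input from variable \<open>k\<close>, leaves its output there and may overwrite all higher
  variables, whose initial contents are arbitrary. Thus programs can be nested by shifting \<open>k\<close>.\<close>

definition computes :: "(nat \<Rightarrow> com) \<Rightarrow> (data \<Rightarrow> data) \<Rightarrow> (data \<Rightarrow> nat) \<Rightarrow> bool" where
  "computes C f g \<longleftrightarrow> (\<forall>k s. \<exists>t s'. exec (C k) s t s' \<and> s' k = f (s k) \<and>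
     (\<forall>j<k. s' j = s j) \<and> t \<le> g (s k))"

text \<open>The size bound does not follow from the time bound: repeatedly assigning
  \<open>Dot x x\<close> to \<open>x\<close> doubles a tree at constant cost. It is what makes
  composition work, since the second program is timed on the output of the first.\<close>

definition ptime :: "(data \<Rightarrow> data) \<Rightarrow> bool" where
  "ptime f \<longleftrightarrow> poly_bounded (\<lambda>d. size (f d)) \<and> (\<exists>C g. poly_bounded g \<and> computes C f g)"

lemma ptimeI: "poly_bounded (\<lambda>d. size (f d)) \<Longrightarrow> poly_bounded g \<Longrightarrow> computes C f g \<Longrightarrow> ptime f"
  unfolding ptime_def by blast

lemma ptimeE:
  assumes "ptime f"
  obtains C g where "poly_bounded (\<lambda>d. size (f d))" "poly_bounded g" "computes C f g"
  using assms unfolding ptime_def by blast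

lemma computesD:
  "computes C f g \<Longrightarrow> \<exists>t s'. exec (C k) s t s' \<and> s' k = f (s k) \<and> (\<forall>j<k. s' j = s j) \<and> t \<le> g (s k)"
  unfolding computes_def by blast

lemma ptime_size: "ptime f \<Longrightarrow> poly_bounded (\<lambda>d. size (f d))"
  unfolding ptime_def by blast

lemma exec_assign: "t = expr_time e + 1 \<Longrightarrow> s' = s(x := eval_expr e s) \<Longrightarrow> exec (Assign x e) s t s'"
  using exec.Assign by simp

lemma size_hd_data: "size (hd_data d) \<le> size d" by (cases d) auto
lemma size_tl_data: "size (tl_data d) \<le> size d" by (cases d) auto

lemma ptime_basic:
  assumes "\<And>k s. eval_expr (e k) s = f (s k)" "\<And>k. expr_time (e k) = t"
    and "poly_bounded (\<lambda>d. size (f d))"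
  shows "ptime f"
proof (rule ptimeI)
  show "computes (\<lambda>k. Assign k (e k)) f (\<lambda>_. t + 1)"
    unfolding computes_def
  proof (intro allI)
    fix k :: nat and s :: store
    have "exec (Assign k (e k)) s (t + 1) (s(k := f (s k)))"
      by (rule exec_assign) (simp_all add: assms)
    then show "\<exists>t' s'. exec (Assign k (e k)) s t' s' \<and> s' k = f (s k) \<and>
        (\<forall>j<k. s' j = s j) \<and> t' \<le> t + 1"
      by (intro exI[of _ "t + 1"] exI[of _ "s(k := f (s k))"]) auto
  qed
qed (use assms poly_bounded_const in auto)

lemma ptime_id: "ptime (\<lambda>d. d)"
  by (rule ptime_basic[of Var _ 1]) (auto simp: poly_bounded_size)

lemma ptime_Atom: "ptime (\<lambda>d. Atom)"
  by (rule ptime_basic[of "\<lambda>_. Quote_Atom" _ 1]) (auto simp: poly_bounded_const)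

lemma ptime_compose:
  assumes "ptime f" "ptime h"
  shows "ptime (\<lambda>d. f (h d))"
proof -
  obtain C g where C: "poly_bounded (\<lambda>d. size (f d))" "poly_bounded g" "computes C f g"
    using assms(1) by (rule ptimeE)
  obtain D q where D: "poly_bounded (\<lambda>d. size (h d))" "poly_bounded q" "computes D h q"
    using assms(2) by (rule ptimeE)
  show ?thesis
  proof (rule ptimeI)
    show "poly_bounded (\<lambda>d. size (f (h d)))" by (rule poly_bounded_compose[OF C(1) D(1)])
    show "poly_bounded (\<lambda>d. q d + g (h d))"
      by (intro poly_bounded_add D(2) poly_bounded_compose[OF C(2) D(1)])
    show "computes (\<lambda>k. Seq (D k) (C k)) (\<lambda>d. f (h d)) (\<lambda>d. q d + g (h d))"
      unfolding computes_def
    proof (intro allI)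
      fix k :: nat and s :: store
      obtain t1 s1 where 1: "exec (D k) s t1 s1" "s1 k = h (s k)" "\<And>j. j < k \<Longrightarrow> s1 j = s j" "t1 \<le> q (s k)"
        using computesD[OF D(3), of "k" "s"] by blast
      obtain t2 s2 where 2: "exec (C k) s1 t2 s2" "s2 k = f (s1 k)" "\<And>j. j < k \<Longrightarrow> s2 j = s1 j" "t2 \<le> g (s1 k)"
        using computesD[OF C(3), of "k" "s1"] by blast
      show "\<exists>t s'. exec (Seq (D k) (C k)) s t s' \<and> s' k = f (h (s k)) \<and>
          (\<forall>j<k. s' j = s j) \<and> t \<le> q (s k) + g (h (s k))"
        using exec.Seq[OF 1(1) 2(1)] 1 2
        by (intro exI[of _ "t1 + t2"] exI[of _ s2]) auto
    qed
  qed
qed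

lemma ptime_hd: "ptime f \<Longrightarrow> ptime (\<lambda>d. hd_data (f d))"
  by (rule ptime_compose[of hd_data])
    (rule ptime_basic[of "\<lambda>k. Hd_Ex (Var k)" _ 2],
      auto intro: poly_bounded_mono[OF poly_bounded_size] simp: size_hd_data)

lemma ptime_tl: "ptime f \<Longrightarrow> ptime (\<lambda>d. tl_data (f d))"
  by (rule ptime_compose[of tl_data])
    (rule ptime_basic[of "\<lambda>k. Tl_Ex (Var k)" _ 2],
      auto intro: poly_bounded_mono[OF poly_bounded_size] simp: size_tl_data)

lemma ptime_Dot:
  assumes "ptime f" "ptime h"
  shows "ptime (\<lambda>d. Dot (f d) (h d))"
proof -
  obtain C g where C: "poly_bounded (\<lambda>d. size (f d))" "poly_bounded g" "computes C f g"
    using assms(1) by (rule ptimeE)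
  obtain D q where D: "poly_bounded (\<lambda>d. size (h d))" "poly_bounded q" "computes D h q"
    using assms(2) by (rule ptimeE)
  show ?thesis
  proof (rule ptimeI)
    show "poly_bounded (\<lambda>d. size (Dot (f d) (h d)))"
      using poly_bounded_add[OF poly_bounded_add[OF C(1) D(1)] poly_bounded_const[of 1]] by simp
    show "poly_bounded (\<lambda>d. g d + q d + 8)"
      by (intro poly_bounded_add C D poly_bounded_const)
    \<comment> \<open>The input stays in \<open>k\<close> while both subprograms work on copies
      above it. The three assignments cost 2 + 2 + 4 = 8 operations.\<close>
    let ?P = "\<lambda>k. Seq (Assign (k+1) (Var k)) (Seq (C (k+1)) (Seq (Assign (k+2) (Var k))
      (Seq (D (k+2)) (Assign k (Cons_Ex (Var (k+1)) (Var (k+2)))))))"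
    show "computes ?P (\<lambda>d. Dot (f d) (h d)) (\<lambda>d. g d + q d + 8)"
      unfolding computes_def
    proof (intro allI)
      fix k :: nat and s :: store
      let ?s = "s(k+1 := s k)"
      obtain t1 s1 where 1: "exec (C (k+1)) ?s t1 s1" "s1 (k+1) = f (?s (k+1))"
        "\<And>j. j < k+1 \<Longrightarrow> s1 j = ?s j" "t1 \<le> g (?s (k+1))"
        using computesD[OF C(3), of "(k+1)" "?s"] by blast
      let ?s1 = "s1(k+2 := s1 k)"
      obtain t2 s2 where 2: "exec (D (k+2)) ?s1 t2 s2" "s2 (k+2) = h (?s1 (k+2))"
        "\<And>j. j < k+2 \<Longrightarrow> s2 j = ?s1 j" "t2 \<le> q (?s1 (k+2))"
        using computesD[OF D(3), of "(k+2)" "?s1"] by blast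
      let ?s3 = "s2(k := Dot (s2 (k+1)) (s2 (k+2)))"
      have a: "exec (Assign (k+1) (Var k)) s 2 ?s" "exec (Assign (k+2) (Var k)) s1 2 ?s1"
        "exec (Assign k (Cons_Ex (Var (k+1)) (Var (k+2)))) s2 4 ?s3"
        by (rule exec_assign; simp)+
      note exec.Seq[OF a(1) exec.Seq[OF 1(1) exec.Seq[OF a(2) exec.Seq[OF 2(1) a(3)]]]]
      then show "\<exists>t s'. exec (?P k) s t s' \<and> s' k = Dot (f (s k)) (h (s k)) \<and>
          (\<forall>j<k. s' j = s j) \<and> t \<le> g (s k) + q (s k) + 8"
        using 1 2 by (intro exI[of _ "2 + (t1 + (2 + (t2 + 4)))"] exI[of _ ?s3]) auto
    qed
  qed
qed

lemma ptime_if_data: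
  assumes "ptime c" "ptime f" "ptime h"
  shows "ptime (\<lambda>d. if c d \<noteq> Atom then f d else h d)"
proof -
  obtain B p where B: "poly_bounded (\<lambda>d. size (c d))" "poly_bounded p" "computes B c p"
    using assms(1) by (rule ptimeE)
  obtain C g where C: "poly_bounded (\<lambda>d. size (f d))" "poly_bounded g" "computes C f g"
    using assms(2) by (rule ptimeE)
  obtain D q where D: "poly_bounded (\<lambda>d. size (h d))" "poly_bounded q" "computes D h q"
    using assms(3) by (rule ptimeE)
  show ?thesis
  proof (rule ptimeI)
    show "poly_bounded (\<lambda>d. size (if c d \<noteq> Atom then f d else h d))"
      by (rule poly_bounded_mono[OF poly_bounded_add[OF C(1) D(1)]]) simp
    show "poly_bounded (\<lambda>d. p d + g d + q d + 4)"
      by (intro poly_bounded_add B C D poly_bounded_const)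
    let ?P = "\<lambda>k. Seq (Assign (k+1) (Var k)) (Seq (B (k+1)) (If_Com (Var (k+1)) (C k) (D k)))"
    show "computes ?P (\<lambda>d. if c d \<noteq> Atom then f d else h d) (\<lambda>d. p d + g d + q d + 4)"
      unfolding computes_def
    proof (intro allI)
      fix k :: nat and s :: store
      let ?s = "s(k+1 := s k)"
      obtain t1 s1 where 1: "exec (B (k+1)) ?s t1 s1" "s1 (k+1) = c (?s (k+1))"
        "\<And>j. j < k+1 \<Longrightarrow> s1 j = ?s j" "t1 \<le> p (?s (k+1))"
        using computesD[OF B(3), of "(k+1)" "?s"] by blast
      obtain t2 s2 where 2: "exec (C k) s1 t2 s2" "s2 k = f (s1 k)"
        "\<And>j. j < k \<Longrightarrow> s2 j = s1 j" "t2 \<le> g (s1 k)"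
        using computesD[OF C(3), of "k" "s1"] by blast
      obtain t3 s3 where 3: "exec (D k) s1 t3 s3" "s3 k = h (s1 k)"
        "\<And>j. j < k \<Longrightarrow> s3 j = s1 j" "t3 \<le> q (s1 k)"
        using computesD[OF D(3), of "k" "s1"] by blast
      have a: "exec (Assign (k+1) (Var k)) s 2 ?s" by (rule exec_assign) auto
      show "\<exists>t s'. exec (?P k) s t s' \<and> s' k = (if c (s k) \<noteq> Atom then f (s k) else h (s k)) \<and>
          (\<forall>j<k. s' j = s j) \<and> t \<le> p (s k) + g (s k) + q (s k) + 4"
      proof (cases "c (s k) = Atom")
        case True
        have "exec (If_Com (Var (k+1)) (C k) (D k)) s1 (2 + t3) s3"
          using exec.IfFalse[of "Var (k+1)" s1 "D k" t3 s3 "C k"] True 1 3 by simp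
        from exec.Seq[OF a exec.Seq[OF 1(1) this]] show ?thesis
          using True 1 3 by (intro exI[of _ "2 + (t1 + (2 + t3))"] exI[of _ s3]) auto
      next
        case False
        have "exec (If_Com (Var (k+1)) (C k) (D k)) s1 (2 + t2) s2"
          using exec.IfTrue[of "Var (k+1)" s1 "C k" t2 s2 "D k"] False 1 2 by simp
        from exec.Seq[OF a exec.Seq[OF 1(1) this]] show ?thesis
          using False 1 2 by (intro exI[of _ "2 + (t1 + (2 + t2))"] exI[of _ s2]) auto
      qed
    qed
  qed
qed

section \<open>Bounded loops along the spine of a tree\<close>

primrec dfold :: "(data \<Rightarrow> data \<Rightarrow> data) \<Rightarrow> data \<Rightarrow> data \<Rightarrow> data" where
  "dfold f Atom a = a"
| "dfold f (Dot x xs) a = dfold f xs (f x a)"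

lemma dfold_size:
  assumes "\<And>x a. size x < size xs \<Longrightarrow> size (f x a) \<le> size a + b"
  shows "size (dfold f xs a) \<le> size a + size xs * b"
  using assms
proof (induction xs arbitrary: a)
  case (Dot x xs)
  have "size (dfold f xs (f x a)) \<le> size (f x a) + size xs * b"
    by (rule Dot.IH(2)) (simp add: Dot.prems)
  also have "\<dots> \<le> size a + b + size xs * b"
    using Dot.prems[of x a] by simp
  finally show ?case by (simp add: algebra_simps)
qed simp

text \<open>The growth of the accumulator in one step is bounded independently of the accumulator;
  otherwise it could double in every step and become exponentially large.\<close>

lemma ptime_dfold_state:
  assumes step: "ptime (\<lambda>z. step (hd_data z) (hd_data (tl_data z)) (tl_data (tl_data z)))"
    and r: "poly_bounded r" "\<And>p e a. size (step p e a) \<le> size a + r (Dot p e)"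
  shows "ptime (\<lambda>d. dfold (step (hd_data d)) (hd_data (tl_data d)) (tl_data (tl_data d)))"
    (is "ptime ?F")
proof -
  let ?step = "\<lambda>z. step (hd_data z) (hd_data (tl_data z)) (tl_data (tl_data z))"
  obtain C g where C: "poly_bounded g" "computes C ?step g"
    using step by (rule ptimeE)
  obtain a b where r_le: "\<And>d. r d \<le> (size d + 2) ^ a" and b: "\<And>d. g d \<le> (size d + 2) ^ b"
    using r(1) C(1) unfolding poly_bounded_def by blast
  \<comment> \<open>\<open>R\<close> bounds the growth in one step, \<open>B\<close> the size of
    every accumulator and \<open>T\<close> the cost of one round: the triple passed to
    \<open>C\<close> has size at most \<open>2 * size d + B d + 2\<close>, and 15 exceeds the 14
    operations spent around \<open>C\<close>.\<close>
  define R where "R d = (size d + 2) ^ a" for d :: data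
  define B where "B d = size d + size d * R d" for d
  define T where "T d = (2 * size d + B d + 4) ^ b + 15" for d
  have pR: "poly_bounded R" unfolding poly_bounded_def R_def by blast
  have pB: "poly_bounded B"
    unfolding B_def by (intro poly_bounded_add poly_bounded_mult poly_bounded_size pR)
  have pT: "poly_bounded T"
  proof -
    have "poly_bounded (\<lambda>d. (2 * size d + B d + 4) ^ b)"
      by (induction b) (auto intro!: poly_bounded_add poly_bounded_mult poly_bounded_size
          poly_bounded_const pB)
    then show ?thesis unfolding T_def by (intro poly_bounded_add poly_bounded_const)
  qed
  let ?W = "\<lambda>k. While (Var (k+1)) (Seq
      (Assign (k+3) (Cons_Ex (Var k) (Cons_Ex (Hd_Ex (Var (k+1))) (Var (k+2)))))
      (Seq (C (k+3)) (Seq (Assign (k+2) (Var (k+3))) (Assign (k+1) (Tl_Ex (Var (k+1)))))))"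
  \<comment> \<open>The last premise reserves growth \<open>R d\<close> for every \<open>Dot\<close>
    node of the unread rest \<open>ys\<close>; a round consumes at least one node and adds at most
    \<open>R d\<close>, so the premise is preserved.\<close>
  have loop: "\<exists>t s'. exec (?W k) s t s' \<and> s' (k+2) = dfold (step p) ys a \<and>
      (\<forall>j<k. s' j = s j) \<and> t \<le> size ys * T d + 2"
    if "s k = p" "s (k+1) = ys" "s (k+2) = a" "size p + size ys \<le> size d"
      "size a + size ys * R d \<le> B d" for ys a d p and s :: store and k :: nat
    using that
  proof (induction ys arbitrary: s a)
    case Atom
    have "exec (?W k) s (expr_time (Var (k+1)) + 1) s"
      by (rule exec.WhileFalse) (use Atom in simp)
    then show ?case using Atom
      by (intro exI[of _ "expr_time (Var (k+1)) + 1"] exI[of _ s]) auto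
  next
    case (Dot e ys)
    let ?z = "Dot p (Dot e a)"
    let ?s = "s(k+3 := ?z)"
    obtain t1 s1 where 1: "exec (C (k+3)) ?s t1 s1" "s1 (k+3) = ?step (?s (k+3))"
      "\<And>j. j < k+3 \<Longrightarrow> s1 j = ?s j" "t1 \<le> g (?s (k+3))"
      using computesD[OF C(2), of "(k+3)" "?s"] by blast
    let ?s2 = "s1(k+2 := step p e a, k+1 := ys)"
    have sz: "size (step p e a) \<le> size a + R d"
    proof -
      have "r (Dot p e) \<le> R d"
        unfolding R_def using Dot.prems(4)
        by (intro order_trans[OF r_le] power_mono) auto
      then show ?thesis using r(2)[of p e a] by linarith
    qed
    have "\<exists>t s'. exec (?W k) ?s2 t s' \<and> s' (k+2) = dfold (step p) ys (step p e a) \<and>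
      (\<forall>j<k. s' j = ?s2 j) \<and> t \<le> size ys * T d + 2"
      using Dot.prems sz 1 by (intro Dot.IH(2)) (auto simp: add_mult_distrib)
    then obtain t2 s3 where 2: "exec (?W k) ?s2 t2 s3" "s3 (k+2) = dfold (step p) ys (step p e a)"
      "\<forall>j<k. s3 j = ?s2 j" "t2 \<le> size ys * T d + 2" by blast
    have t1: "t1 + 15 \<le> T d"
    proof -
      have "g ?z \<le> (size ?z + 2) ^ b" by (rule b)
      also have "\<dots> \<le> (2 * size d + B d + 4) ^ b"
        using Dot.prems(4,5) by (intro power_mono) auto
      finally show ?thesis using 1(4) by (simp add: T_def)
    qed
    have a: "exec (Assign (k+3) (Cons_Ex (Var k) (Cons_Ex (Hd_Ex (Var (k+1))) (Var (k+2))))) s 7 ?s"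
      "exec (Assign (k+2) (Var (k+3))) s1 2 (s1(k+2 := step p e a))"
      "exec (Assign (k+1) (Tl_Ex (Var (k+1)))) (s1(k+2 := step p e a)) 3 ?s2"
      using Dot.prems 1(2,3) by - (rule exec_assign; simp)+
    have "exec (?W k) s (expr_time (Var (k+1)) + 1 + (7 + (t1 + (2 + 3))) + t2) s3"
      by (rule exec.WhileTrue[OF _ exec.Seq[OF a(1) exec.Seq[OF 1(1) exec.Seq[OF a(2,3)]]] 2(1)])
        (use Dot.prems in simp)
    then show ?case using 1 2 t1 Dot.prems
      by (intro exI[of _ "expr_time (Var (k+1)) + 1 + (7 + (t1 + (2 + 3))) + t2"] exI[of _ s3]) (auto simp: add_mult_distrib)
  qed
  show ?thesis
  proof (rule ptimeI)
    have "size (?F d) \<le> B d" for d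
    proof -
      have "size (?F d) \<le> size (tl_data (tl_data d)) + size (hd_data (tl_data d)) * R d"
      proof (rule dfold_size)
        fix x u :: data assume "size x < size (hd_data (tl_data d))"
        then have "size (Dot (hd_data d) x) \<le> size d"
          by (cases d; cases "tl_data d") auto
        then have "r (Dot (hd_data d) x) \<le> R d"
          unfolding R_def by (intro order_trans[OF r_le] power_mono) auto
        then show "size (step (hd_data d) x u) \<le> size u + R d"
          using r(2)[of "hd_data d" x u] by linarith
      qed
      also have "\<dots> \<le> B d"
        unfolding B_def by (intro add_mono mult_le_mono1 order_trans[OF size_tl_data]
            order_trans[OF size_hd_data] order_refl)
      finally show ?thesis .
    qed
    then show "poly_bounded (\<lambda>d. size (?F d))" by (rule poly_bounded_mono[OF pB])
    show "poly_bounded (\<lambda>d. size d * T d + 15)"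
      by (intro poly_bounded_add poly_bounded_mult poly_bounded_size poly_bounded_const pT)
    let ?P = "\<lambda>k. Seq (Assign (k+1) (Hd_Ex (Tl_Ex (Var k)))) (Seq (Assign (k+2) (Tl_Ex (Tl_Ex (Var k))))
      (Seq (Assign k (Hd_Ex (Var k))) (Seq (?W k) (Assign k (Var (k+2))))))"
    show "computes ?P ?F (\<lambda>d. size d * T d + 15)"
      unfolding computes_def
    proof (intro allI)
      fix k :: nat and s :: store
      let ?d = "s k"
      let ?s = "s(k+1 := hd_data (tl_data ?d), k+2 := tl_data (tl_data ?d), k := hd_data ?d)"
      have "\<exists>t s'. exec (?W k) ?s t s' \<and> s' (k+2) = ?F ?d \<and>
        (\<forall>j<k. s' j = ?s j) \<and> t \<le> size (hd_data (tl_data ?d)) * T ?d + 2"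
      proof (rule loop)
        show "size (hd_data ?d) + size (hd_data (tl_data ?d)) \<le> size ?d"
          by (cases ?d; cases "tl_data ?d") auto
        show "size (tl_data (tl_data ?d)) + size (hd_data (tl_data ?d)) * R ?d \<le> B ?d"
          unfolding B_def by (intro add_mono mult_le_mono1 order_trans[OF size_tl_data]
            order_trans[OF size_hd_data] order_refl)
      qed auto
      then obtain t s' where s': "exec (?W k) ?s t s'" "s' (k+2) = ?F ?d"
        "\<forall>j<k. s' j = ?s j" "t \<le> size (hd_data (tl_data ?d)) * T ?d + 2" by blast
      have a: "exec (Assign (k+1) (Hd_Ex (Tl_Ex (Var k)))) s 4 (s(k+1 := hd_data (tl_data ?d)))"
        "exec (Assign (k+2) (Tl_Ex (Tl_Ex (Var k)))) (s(k+1 := hd_data (tl_data ?d))) 4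
          (s(k+1 := hd_data (tl_data ?d), k+2 := tl_data (tl_data ?d)))"
        "exec (Assign k (Hd_Ex (Var k))) (s(k+1 := hd_data (tl_data ?d), k+2 := tl_data (tl_data ?d))) 3 ?s"
        "exec (Assign k (Var (k+2))) s' 2 (s'(k := s' (k+2)))"
        by (rule exec_assign; simp)+
      note exec.Seq[OF a(1) exec.Seq[OF a(2) exec.Seq[OF a(3) exec.Seq[OF s'(1) a(4)]]]]
      moreover have "t \<le> size ?d * T ?d + 2"
        by (rule order_trans[OF s'(4)]) (intro add_mono mult_le_mono1 order_trans[OF size_tl_data]
            order_trans[OF size_hd_data] order_refl)
      ultimately show "\<exists>t s'. exec (?P k) s t s' \<and> s' k = ?F ?d \<and>
          (\<forall>j<k. s' j = s j) \<and> t \<le> size ?d * T ?d + 15"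
        using s' by (intro exI[of _ "4 + (4 + (3 + (t + 2)))"] exI[of _ "s'(k := s' (k+2))"]) auto
    qed
  qed
qed

lemma ptime_dfold:
  assumes "ptime (\<lambda>z. step (hd_data z) (hd_data (tl_data z)) (tl_data (tl_data z)))"
    and "poly_bounded r" "\<And>p e a. size (step p e a) \<le> size a + r (Dot p e)"
    and "ptime p" "ptime xs" "ptime a"
  shows "ptime (\<lambda>d. dfold (step (p d)) (xs d) (a d))"
  using ptime_compose[OF ptime_dfold_state[OF assms(1-3)] ptime_Dot[OF assms(4) ptime_Dot[OF assms(5,6)]]]
  by simp

lemma polynomial_time_if_ptime:
  assumes "ptime f"
  obtains P where "polynomial_time P" "\<And>d. outputs P d (f d)"
proof -
  obtain C g where C: "poly_bounded g" "computes C f g" using assms by (rule ptimeE)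
  obtain k where k: "\<And>d. g d \<le> (size d + 2) ^ k" using C(1) unfolding poly_bounded_def by blast
  have h: "\<exists>t. halts_in (C 0) d t (f d) \<and> t \<le> poly ([:2, 1:] ^ k) (size d)" for d
  proof -
    obtain t s' where "exec (C 0) ((\<lambda>_. Atom)(0 := d)) t s'" "s' 0 = f d" "t \<le> g d"
      using computesD[OF C(2), of 0 "(\<lambda>_. Atom)(0 := d)"] by auto
    moreover have "poly ([:2, 1:] ^ k) (size d) = (size d + 2) ^ k"
      by (simp add: poly_power add.commute)
    ultimately show ?thesis using k[of d] unfolding halts_in_def by (metis le_trans)
  qed
  show ?thesis
  proof
    show "polynomial_time (C 0)" unfolding polynomial_time_def using h by blast
    show "outputs (C 0) d (f d)" for d unfolding outputs_def using h by blast
  qed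
qed

section \<open>Predicates decidable in polynomial time\<close>

definition pdec :: "(data \<Rightarrow> bool) \<Rightarrow> bool" where
  "pdec P \<longleftrightarrow> ptime (\<lambda>d. if P d then Dot Atom Atom else Atom)"

lemma pdec_nonAtom: "ptime f \<Longrightarrow> pdec (\<lambda>d. f d \<noteq> Atom)"
  unfolding pdec_def by (rule ptime_if_data[OF _ ptime_Dot[OF ptime_Atom ptime_Atom] ptime_Atom])

lemma ptime_if:
  assumes "pdec P" "ptime f" "ptime g"
  shows "ptime (\<lambda>d. if P d then f d else g d)"
proof -
  have "(if (if P d then Dot Atom Atom else Atom) \<noteq> Atom then f d else g d) =
    (if P d then f d else g d)" for d by simp
  then show ?thesis using ptime_if_data[OF assms(1)[unfolded pdec_def] assms(2,3)] by simp
qed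

lemma pdec_compose: "pdec P \<Longrightarrow> ptime f \<Longrightarrow> pdec (\<lambda>d. P (f d))"
  unfolding pdec_def by (rule ptime_compose)

lemma pdec_if:
  assumes "pdec P" "pdec Q" "pdec R"
  shows "pdec (\<lambda>d. if P d then Q d else R d)"
proof -
  have *: "(if if P d then Q d else R d then Dot Atom Atom else Atom) =
    (if P d then if Q d then Dot Atom Atom else Atom else if R d then Dot Atom Atom else Atom)" for d
    by simp
  show ?thesis
    unfolding pdec_def * using assms by (intro ptime_if) (auto simp: pdec_def intro: ptime_Dot ptime_Atom)
qed

lemma pdec_const: "pdec (\<lambda>_. b)"
  unfolding pdec_def by (cases b) (auto intro: ptime_Dot ptime_Atom)

lemma pdec_not: "pdec P \<Longrightarrow> pdec (\<lambda>d. \<not> P d)"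
  using pdec_if[of P "\<lambda>_. False" "\<lambda>_. True"] by (simp add: pdec_const if_bool_eq_conj)

lemma pdec_conj: "pdec P \<Longrightarrow> pdec Q \<Longrightarrow> pdec (\<lambda>d. P d \<and> Q d)"
  using pdec_if[of P Q "\<lambda>_. False"] by (simp add: pdec_const if_bool_eq_disj)

lemma pdec_disj: "pdec P \<Longrightarrow> pdec Q \<Longrightarrow> pdec (\<lambda>d. P d \<or> Q d)"
  using pdec_not[OF pdec_conj[OF pdec_not pdec_not], of P Q] by simp

lemma pdec_eq_Atom: "ptime f \<Longrightarrow> pdec (\<lambda>d. f d = Atom)"
  using pdec_not[OF pdec_nonAtom] by simp

lemmas ptime_intros = ptime_id ptime_Atom ptime_hd ptime_tl ptime_Dot ptime_if
  pdec_if pdec_conj pdec_disj pdec_not pdec_eq_Atom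

primrec dset :: "data \<Rightarrow> data set" where
  "dset Atom = {}"
| "dset (Dot x xs) = insert x (dset xs)"

lemma size_dset: "x \<in> dset xs \<Longrightarrow> size x < size xs"
  by (induction xs) auto

lemma dfold_invariant:
  assumes "I a" "\<And>x a. x \<in> dset xs \<Longrightarrow> I a \<Longrightarrow> I (f x a)"
  shows "I (dfold f xs a)"
  using assms by (induction xs arbitrary: a) auto

text \<open>Here the list is only a clock. The vertex list serves in this way wherever a step has to
  be repeated often enough.\<close>

lemma ptime_dfold_const:
  assumes "ptime (\<lambda>z. step (hd_data z) (tl_data z))"
    and "poly_bounded r" "\<And>p a. size (step p a) \<le> size a + r p"
    and "ptime p" "ptime xs" "ptime a"
  shows "ptime (\<lambda>d. dfold (\<lambda>_. step (p d)) (xs d) (a d))"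
proof (rule ptime_dfold[where step = "\<lambda>p _. step p" and r = "\<lambda>d. r (hd_data d)"])
  show "ptime (\<lambda>z. step (hd_data z) (tl_data (tl_data z)))"
    using ptime_compose[OF assms(1) ptime_Dot[OF ptime_hd[OF ptime_id] ptime_tl[OF ptime_tl[OF ptime_id]]]]
    by simp
  show "poly_bounded (\<lambda>d. r (hd_data d))"
    by (rule poly_bounded_compose[OF assms(2)]) (rule poly_bounded_mono[OF poly_bounded_size], rule size_hd_data)
qed (use assms in auto)

section \<open>The algorithm on trees\<close>

subsection \<open>Searching\<close>

text \<open>The last match is returned as a list of length one, because \<open>Atom\<close> also encodes the vertex \<open>0\<close>.\<close>

definition dpick :: "(data \<Rightarrow> bool) \<Rightarrow> data \<Rightarrow> data \<Rightarrow> data" where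
  "dpick P = dfold (\<lambda>e acc. if P e then Dot e Atom else acc)"

lemma size_dpick: "size (dpick P xs acc) \<le> max (size acc) (size xs)"
  unfolding dpick_def by (rule dfold_invariant) (auto dest: size_dset)

lemma ptime_dpick:
  assumes "pdec (\<lambda>z. P (hd_data z) (tl_data z))" "ptime p" "ptime xs" "ptime acc"
  shows "ptime (\<lambda>d. dpick (P (p d)) (xs d) (acc d))"
  unfolding dpick_def
proof (rule ptime_dfold[where step = "\<lambda>p e acc. if P p e then Dot e Atom else acc" and r = "\<lambda>d. size d"])
  show "ptime (\<lambda>z. if P (hd_data z) (hd_data (tl_data z)) then Dot (hd_data (tl_data z)) Atom
    else tl_data (tl_data z))"
    using pdec_compose[OF assms(1) ptime_Dot[OF ptime_hd[OF ptime_id] ptime_hd[OF ptime_tl[OF ptime_id]]]]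
    by (intro ptime_intros) simp
qed (use assms in \<open>auto simp: poly_bounded_size\<close>)

lemma dfold_bex: "dfold (\<lambda>e acc. if P e then Dot Atom Atom else acc) xs acc =
    (if \<exists>e\<in>dset xs. P e then Dot Atom Atom else acc)"
  by (induction xs arbitrary: acc) auto

lemma pdec_bex:
  assumes "pdec (\<lambda>z. P (hd_data z) (tl_data z))" "ptime p" "ptime xs"
  shows "pdec (\<lambda>d. \<exists>e\<in>dset (xs d). P (p d) e)"
proof -
  have "ptime (\<lambda>d. dfold (\<lambda>e acc. if P (p d) e then Dot Atom Atom else acc) (xs d) Atom)"
  proof (rule ptime_dfold[where step = "\<lambda>p e acc. if P p e then Dot Atom Atom else acc" and r = "\<lambda>_. 1"])
    show "ptime (\<lambda>z. if P (hd_data z) (hd_data (tl_data z)) then Dot Atom Atom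
      else tl_data (tl_data z))"
      using pdec_compose[OF assms(1) ptime_Dot[OF ptime_hd[OF ptime_id] ptime_hd[OF ptime_tl[OF ptime_id]]]]
      by (intro ptime_intros) simp
  qed (use assms in \<open>auto simp: poly_bounded_const intro: ptime_intros\<close>)
  then show ?thesis unfolding dfold_bex pdec_def .
qed

subsection \<open>Equality of labels\<close>

text \<open>The accumulator is \<open>Atom\<close> once a mismatch has been found and otherwise
  \<open>Dot Atom b\<close>, with \<open>b\<close> the unread bits of the second label. The extra
  \<open>Dot\<close> separates an exhausted label from a failure.\<close>

definition eq_step :: "data \<Rightarrow> data \<Rightarrow> data" where
  "eq_step x s = (if s = Atom then Atom else if tl_data s = Atom then Atom
     else if (if x = Atom then hd_data (tl_data s) = Atom else \<not> hd_data (tl_data s) = Atom)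
     then Dot Atom (tl_data (tl_data s)) else Atom)"

definition deq :: "data \<Rightarrow> data \<Rightarrow> bool" where
  "deq a b \<longleftrightarrow> dfold eq_step a (Dot Atom b) = Dot Atom Atom"

lemma dfold_eq_step_Atom [simp]: "dfold eq_step a Atom = Atom"
  by (induction a) (auto simp: eq_step_def)

lemma deq_simps [simp]:
  "deq Atom b \<longleftrightarrow> b = Atom"
  "deq (Dot x a) Atom \<longleftrightarrow> False"
  "deq (Dot x a) (Dot y b) \<longleftrightarrow> (x = Atom \<longleftrightarrow> y = Atom) \<and> deq a b"
  by (auto simp: deq_def eq_step_def)

lemma deq_refl [simp]: "deq a a"
  by (induction a) auto

text \<open>On arbitrary trees \<open>deq\<close> confuses entries that are both different from
  \<open>Atom\<close>. On labels it is exact, because each bit is either \<open>Atom\<close> or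
  \<open>Dot Atom Atom\<close>.\<close>

lemma deq_enc_nat [simp]: "deq (enc_nat a) (enc_nat b) \<longleftrightarrow> a = b"
proof (induction a arbitrary: b rule: less_induct)
  case (less a)
  show ?case
  proof (cases "a = 0 \<or> b = 0")
    case True
    then show ?thesis by (auto simp: enc_nat.simps[of a] enc_nat.simps[of b])
  next
    case False
    then have "deq (enc_nat a) (enc_nat b) \<longleftrightarrow> (even a \<longleftrightarrow> even b) \<and> a div 2 = b div 2"
      using less.IH[of "a div 2" "b div 2"]
      by (simp add: enc_nat.simps[of a] enc_nat.simps[of b])
    also have "\<dots> \<longleftrightarrow> a = b"
      by (metis even_two_times_div_two odd_two_times_div_two_succ)
    finally show ?thesis .
  qed
qed

lemma pdec_deq:
  assumes "ptime a" "ptime b"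
  shows "pdec (\<lambda>d. deq (a d) (b d))"
proof -
  have *: "ptime (\<lambda>d. dfold eq_step (a d) (Dot Atom (b d)))"
  proof (rule ptime_dfold[where step = "\<lambda>_. eq_step" and r = "\<lambda>_. 0" and p = "\<lambda>_. Atom"])
    show "ptime (\<lambda>z. eq_step (hd_data (tl_data z)) (tl_data (tl_data z)))"
      unfolding eq_step_def by (intro ptime_intros)
    show "size (eq_step e s) \<le> size s + 0" for e s
      unfolding eq_step_def by (cases s; cases "tl_data s") auto
  qed (use assms in \<open>auto simp: poly_bounded_const intro: ptime_intros\<close>)
  \<comment> \<open>Only tests against \<open>Atom\<close> are available. The head of a successful
    accumulator is always \<open>Atom\<close>, so examining the accumulator and its tail is enough
    to recognise \<open>Dot Atom Atom\<close>.\<close>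
  have **: "dfold eq_step xs s = Dot Atom Atom \<longleftrightarrow>
    \<not> dfold eq_step xs s = Atom \<and> tl_data (dfold eq_step xs s) = Atom"
    if "s = Atom \<or> hd_data s = Atom" for xs s
  proof -
    have "dfold eq_step xs s = Atom \<or> hd_data (dfold eq_step xs s) = Atom"
      by (rule dfold_invariant) (use that in \<open>auto simp: eq_step_def\<close>)
    then show ?thesis by (cases "dfold eq_step xs s") auto
  qed
  have "deq (a d) (b d) \<longleftrightarrow> \<not> dfold eq_step (a d) (Dot Atom (b d)) = Atom \<and>
    tl_data (dfold eq_step (a d) (Dot Atom (b d))) = Atom" for d
    unfolding deq_def by (rule **) simp
  then show ?thesis using * by (simp add: ptime_intros)
qed

definition dmem :: "data \<Rightarrow> data \<Rightarrow> bool" where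
  "dmem v xs \<longleftrightarrow> (\<exists>e\<in>dset xs. deq e v)"

lemma pdec_dmem:
  assumes "ptime v" "ptime xs" shows "pdec (\<lambda>d. dmem (v d) (xs d))"
  unfolding dmem_def
  by (rule pdec_bex[where P = "\<lambda>v e. deq e v"]) (intro assms ptime_intros pdec_deq)+

definition dadj :: "data \<Rightarrow> data \<Rightarrow> data \<Rightarrow> bool" where
  "dadj D a b \<longleftrightarrow> (\<exists>e\<in>dset D. deq (hd_data e) a \<and> deq (tl_data e) b)"

lemma pdec_dadj:
  assumes "ptime D" "ptime a" "ptime b" shows "pdec (\<lambda>d. dadj (D d) (a d) (b d))"
proof -
  have "pdec (\<lambda>d. \<exists>e\<in>dset (D d). deq (hd_data e) (hd_data (Dot (a d) (b d))) \<and>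
      deq (tl_data e) (tl_data (Dot (a d) (b d))))"
    by (rule pdec_bex[where P = "\<lambda>v e. deq (hd_data e) (hd_data v) \<and> deq (tl_data e) (tl_data v)"])
      (intro assms ptime_intros pdec_deq)+
  then show ?thesis by (simp add: dadj_def)
qed

lemmas p_intros = ptime_intros pdec_deq pdec_dmem pdec_dadj

text \<open>The degree is counted in unary, as a list of \<open>Atom\<close> entries; three tails
  exhaust it exactly when it has at most three entries.\<close>

definition dlow_degree :: "data \<Rightarrow> data \<Rightarrow> data \<Rightarrow> bool" where
  "dlow_degree VS D w \<longleftrightarrow> tl_data (tl_data (tl_data
     (dfold (\<lambda>z acc. if dadj D w z then Dot Atom acc else acc) VS Atom))) = Atom"

lemma pdec_dlow_degree:
  assumes "ptime VS" "ptime D" "ptime w"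
  shows "pdec (\<lambda>d. dlow_degree (VS d) (D d) (w d))"
proof -
  have "ptime (\<lambda>d. dfold (\<lambda>z acc. if dadj (hd_data (Dot (D d) (w d))) (tl_data (Dot (D d) (w d))) z
     then Dot Atom acc else acc) (VS d) Atom)"
    by (rule ptime_dfold[where step = "\<lambda>p z acc. if dadj (hd_data p) (tl_data p) z then Dot Atom acc else acc"
        and r = "\<lambda>_. 1"]) (use assms in \<open>auto intro!: p_intros poly_bounded_const\<close>)
  then show ?thesis unfolding dlow_degree_def by (intro p_intros) simp
qed

subsection \<open>The greedy path\<close>

text \<open>The arguments \<open>q\<close> of the step functions below are tuples \<open>Dot VS D\<close>,
  where \<open>VS\<close> lists the vertices and \<open>D\<close> lists every edge in both directions.\<close>

definition dpath_choice :: "data \<Rightarrow> data \<Rightarrow> data" where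
  "dpath_choice q p =
    dpick (\<lambda>w. dadj (tl_data q) (hd_data p) w \<and> \<not> dmem w p \<and>
        (\<exists>z\<in>dset p. \<not> deq z (hd_data p) \<and> dadj (tl_data q) z w)) (hd_data q)
     (dpick (\<lambda>w. dadj (tl_data q) (hd_data p) w \<and> \<not> dmem w p \<and>
        dlow_degree (hd_data q) (tl_data q) w) (hd_data q)
       (dpick (\<lambda>w. dadj (tl_data q) (hd_data p) w \<and> \<not> dmem w p) (hd_data q) Atom))"

definition dpath_step :: "data \<Rightarrow> data \<Rightarrow> data" where
  "dpath_step q p =
    (if dpath_choice q p = Atom then p else Dot (hd_data (dpath_choice q p)) p)"

lemma ptime_dpath_choice:
  assumes "ptime q" "ptime p" shows "ptime (\<lambda>d. dpath_choice (q d) (p d))"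
proof -
  have hug: "pdec (\<lambda>u. \<exists>z\<in>dset (tl_data (hd_data u)). \<not> deq z (hd_data (tl_data (hd_data u))) \<and>
      dadj (tl_data (hd_data (hd_data u))) z (tl_data u))"
    by (rule pdec_bex[where P = "\<lambda>u z. \<not> deq z (hd_data (tl_data (hd_data u))) \<and>
      dadj (tl_data (hd_data (hd_data u))) z (tl_data u)" and p = "\<lambda>u. u"]) (intro p_intros)+
  have "ptime (\<lambda>d. dpath_choice (hd_data (Dot (q d) (p d))) (tl_data (Dot (q d) (p d))))"
    unfolding dpath_choice_def
    by (rule ptime_dpick[where p = "\<lambda>d. Dot (q d) (p d)" and P = "\<lambda>u w. dadj (tl_data (hd_data u)) (hd_data (tl_data u)) w \<and>
         \<not> dmem w (tl_data u) \<and> (\<exists>z\<in>dset (tl_data u). \<not> deq z (hd_data (tl_data u)) \<and> dadj (tl_data (hd_data u)) z w)"]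
       ptime_dpick[where p = "\<lambda>d. Dot (q d) (p d)" and P = "\<lambda>u w. dadj (tl_data (hd_data u)) (hd_data (tl_data u)) w \<and>
         \<not> dmem w (tl_data u) \<and> dlow_degree (hd_data (hd_data u)) (tl_data (hd_data u)) w"]
       ptime_dpick[where p = "\<lambda>d. Dot (q d) (p d)" and P = "\<lambda>u w. dadj (tl_data (hd_data u)) (hd_data (tl_data u)) w \<and>
         \<not> dmem w (tl_data u)"] | intro hug assms p_intros pdec_dlow_degree)+
  then show ?thesis by simp
qed

lemma size_hd_le: "size d \<le> n \<Longrightarrow> size (hd_data d) \<le> n"
  using size_hd_data le_trans by blast

lemma size_tl_le: "size d \<le> n \<Longrightarrow> size (tl_data d) \<le> n"
  using size_tl_data le_trans by blast

text \<open>The bound does not involve the path \<open>p\<close>: the choice is empty or a single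
  entry of the vertex list. This gives the growth bound, independent of the accumulator, that
  iterating \<open>dpath_step\<close> requires.\<close>

lemma size_dpath_choice: "size (dpath_choice q p) \<le> size q"
  unfolding dpath_choice_def
  by (intro order_trans[OF size_dpick] max.boundedI size_hd_le) auto

lemma ptime_dpath_step:
  assumes "ptime q" "ptime p" shows "ptime (\<lambda>d. dpath_step (q d) (p d))"
  unfolding dpath_step_def using assms by (intro p_intros ptime_dpath_choice)

definition dpath :: "data \<Rightarrow> data \<Rightarrow> data \<Rightarrow> data" where
  "dpath q a b = dfold (\<lambda>_. dpath_step q) (hd_data q) (Dot b (Dot a Atom))"

lemma ptime_dpath:
  assumes "ptime q" "ptime a" "ptime b" shows "ptime (\<lambda>d. dpath (q d) (a d) (b d))"
  unfolding dpath_def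
proof (rule ptime_dfold_const[where step = dpath_step and r = "\<lambda>q. size q + 1"])
  show "poly_bounded (\<lambda>q. size q + 1)"
    by (intro poly_bounded_add poly_bounded_size poly_bounded_const)
  show "size (dpath_step q p) \<le> size p + (size q + 1)" for q p
    using size_hd_le[OF size_dpath_choice, of q p] by (auto simp: dpath_step_def)
qed (intro assms p_intros ptime_dpath_step)+

subsection \<open>Closing the path\<close>

text \<open>The path \<open>p\<close> has its newest vertex in front and \<open>dpick\<close>
  returns the last match, so the chosen neighbour is the one visited earliest.\<close>

definition dback_step :: "data \<Rightarrow> data \<Rightarrow> data \<Rightarrow> data \<Rightarrow> data" where
  "dback_step D p a r = (if deq (hd_data r) a then r else
     if dpick (\<lambda>w. dadj D w (hd_data r)) p Atom = Atom then r
     else Dot (hd_data (dpick (\<lambda>w. dadj D w (hd_data r)) p Atom)) r)"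

lemma ptime_dback_step:
  assumes "ptime D" "ptime p" "ptime a" "ptime r"
  shows "ptime (\<lambda>d. dback_step (D d) (p d) (a d) (r d))"
proof -
  have "ptime (\<lambda>d. dpick (\<lambda>w. dadj (hd_data (Dot (D d) (r d))) w (hd_data (tl_data (Dot (D d) (r d))))) (p d) Atom)"
    by (rule ptime_dpick[where P = "\<lambda>u w. dadj (hd_data u) w (hd_data (tl_data u))"])
      (intro assms p_intros)+
  then have "ptime (\<lambda>d. dpick (\<lambda>w. dadj (D d) w (hd_data (r d))) (p d) Atom)" by simp
  then show ?thesis unfolding dback_step_def by (intro assms p_intros)
qed

text \<open>If the way back has not reached \<open>a\<close> when the clock runs out, the one-vertex
  walk replaces the attempt. The result is thus closed for every starting edge, and detours can
  complete it.\<close>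

definition dclosed :: "data \<Rightarrow> data \<Rightarrow> data \<Rightarrow> data" where
  "dclosed q a p = (if deq (hd_data (dfold (\<lambda>_. dback_step (tl_data q) p a) (hd_data q) p)) a
     then dfold (\<lambda>_. dback_step (tl_data q) p a) (hd_data q) p else Dot a Atom)"

lemma ptime_dclosed:
  assumes "ptime q" "ptime a" "ptime p"
  shows "ptime (\<lambda>d. dclosed (q d) (a d) (p d))"
proof -
  have "ptime (\<lambda>d. dfold (\<lambda>_. dback_step (tl_data (hd_data (Dot (q d) (Dot (a d) (p d)))))
    (tl_data (tl_data (Dot (q d) (Dot (a d) (p d)))))
    (hd_data (tl_data (Dot (q d) (Dot (a d) (p d)))))) (hd_data (q d)) (p d))"
  proof (rule ptime_dfold_const[where r = "\<lambda>u. size u + 1" and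
        step = "\<lambda>u. dback_step (tl_data (hd_data u)) (tl_data (tl_data u)) (hd_data (tl_data u))"])
    show "poly_bounded (\<lambda>q. size q + 1)"
      by (intro poly_bounded_add poly_bounded_size poly_bounded_const)
    show "size (dback_step (tl_data (hd_data u)) (tl_data (tl_data u)) (hd_data (tl_data u)) a)
        \<le> size a + (size u + 1)" for u a
    proof -
      have "size (hd_data (dpick P (tl_data (tl_data u)) Atom)) \<le> size u" for P
        by (intro size_hd_le order_trans[OF size_dpick] max.boundedI size_tl_le) auto
      then show ?thesis by (auto simp: dback_step_def)
    qed
  qed (intro assms p_intros ptime_dback_step)+
  then have "ptime (\<lambda>d. dfold (\<lambda>_. dback_step (tl_data (q d)) (p d) (a d)) (hd_data (q d)) (p d))" by simp
  then show ?thesis unfolding dclosed_def by (intro assms p_intros)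
qed

subsection \<open>Adding detours\<close>

text \<open>The new vertex \<open>tl_data e\<close> is in the accumulator once it has been inserted, so that the
  detour is made only at the first occurrence of \<open>hd_data e\<close>. The result is the reversed walk.\<close>

definition dinsert_step :: "data \<Rightarrow> data \<Rightarrow> data \<Rightarrow> data" where
  "dinsert_step e x acc = (if deq x (hd_data e) \<and> \<not> dmem (tl_data e) acc
     then Dot (hd_data e) (Dot (tl_data e) (Dot x acc)) else Dot x acc)"

definition dinsert :: "data \<Rightarrow> data \<Rightarrow> data" where
  "dinsert e W = dfold (dinsert_step e) W Atom"

text \<open>Amortised: an allowance \<open>c\<close> for the detour is held while the new vertex is
  absent from the accumulator and is spent by the insertion, after which the vertex is present. So
  the detour is paid for once, however often \<open>hd_data e\<close> occurs.\<close>

lemma size_dinsert: "size (dinsert e W) \<le> size W + 2 * size e + 2"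
proof -
  have "size (dfold (dinsert_step e) W acc) + (if dmem (tl_data e) (dfold (dinsert_step e) W acc) then 0 else c)
    \<le> size W + size acc + (if dmem (tl_data e) acc then 0 else c)" if "c = 2 * size e + 2" for acc c
  proof (induction W arbitrary: acc)
    case (Dot x W)
    have "size (dinsert_step e x acc) + (if dmem (tl_data e) (dinsert_step e x acc) then 0 else c)
      \<le> size x + 1 + size acc + (if dmem (tl_data e) acc then 0 else c)"
      using that size_hd_data[of e] size_tl_data[of e] by (auto simp: dinsert_step_def dmem_def)
    then show ?case using Dot(2)[of "dinsert_step e x acc"] by simp
  qed simp
  from this[OF refl, of Atom] show ?thesis by (auto simp: dinsert_def split: if_splits)
qed

lemma ptime_dinsert:
  assumes "ptime e" "ptime W" shows "ptime (\<lambda>d. dinsert (e d) (W d))"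
  unfolding dinsert_def
proof (rule ptime_dfold[where step = dinsert_step and r = "\<lambda>z. 2 * size z + 3"])
  show "poly_bounded (\<lambda>q. 2 * size q + 3)"
    by (intro poly_bounded_add poly_bounded_mult poly_bounded_size poly_bounded_const)
  show "size (dinsert_step e x acc) \<le> size acc + (2 * size (Dot e x) + 3)" for e x acc
    using size_hd_data[of e] size_tl_data[of e] by (auto simp: dinsert_step_def)
qed (unfold dinsert_step_def, (intro assms p_intros)+)

definition dcomplete_step :: "data \<Rightarrow> data \<Rightarrow> data" where
  "dcomplete_step D W =
    (if dpick (\<lambda>e. dmem (hd_data e) W \<and> \<not> dmem (tl_data e) W) D Atom = Atom then W
     else dinsert (hd_data (dpick (\<lambda>e. dmem (hd_data e) W \<and> \<not> dmem (tl_data e) W) D Atom)) W)"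

lemma ptime_dcomplete_step:
  assumes "ptime D" "ptime W" shows "ptime (\<lambda>d. dcomplete_step (D d) (W d))"
proof -
  have "ptime (\<lambda>d. dpick (\<lambda>e. dmem (hd_data e) (W d) \<and> \<not> dmem (tl_data e) (W d)) (D d) Atom)"
    by (rule ptime_dpick[where P = "\<lambda>W e. dmem (hd_data e) W \<and> \<not> dmem (tl_data e) W"])
      (intro assms p_intros)+
  then show ?thesis unfolding dcomplete_step_def by (intro assms p_intros ptime_dinsert)
qed

definition dcomplete :: "data \<Rightarrow> data \<Rightarrow> data" where
  "dcomplete q W = dfold (\<lambda>_. dcomplete_step (tl_data q)) (hd_data q) W"

lemma ptime_dcomplete:
  assumes "ptime q" "ptime W" shows "ptime (\<lambda>d. dcomplete (q d) (W d))"
  unfolding dcomplete_def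
proof (rule ptime_dfold_const[where step = dcomplete_step and r = "\<lambda>D. 2 * size D + 2"])
  show "poly_bounded (\<lambda>q. 2 * size q + 2)"
    by (intro poly_bounded_add poly_bounded_mult poly_bounded_size poly_bounded_const)
  show "size (dcomplete_step D W) \<le> size W + (2 * size D + 2)" for D W
  proof -
    let ?c = "dpick (\<lambda>e. dmem (hd_data e) W \<and> \<not> dmem (tl_data e) W) D Atom"
    have "size (hd_data ?c) \<le> size D"
      by (intro size_hd_le order_trans[OF size_dpick]) auto
    then show ?thesis using size_dinsert[of "hd_data ?c" W] by (auto simp: dcomplete_step_def)
  qed
qed (intro assms p_intros ptime_dcomplete_step)+

subsection \<open>The best candidate\<close>

text \<open>The \<open>else\<close> branch is the walk of length 0 for the case that the tail of
  \<open>e\<close> alone covers \<open>X\<close>. As all edges are tried in both directions, every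
  vertex with an incident edge is tested.\<close>

definition dcandidate :: "data \<Rightarrow> data \<Rightarrow> data \<Rightarrow> data" where
  "dcandidate q X e = (if \<exists>x\<in>dset X. \<not> (deq (hd_data x) (hd_data e) \<or> deq (tl_data x) (hd_data e))
     then dcomplete q (dclosed q (hd_data e) (dpath q (hd_data e) (tl_data e))) else Dot (hd_data e) Atom)"

lemma ptime_dcandidate:
  assumes "ptime q" "ptime X" "ptime e" shows "ptime (\<lambda>d. dcandidate (q d) (X d) (e d))"
  unfolding dcandidate_def
  by (intro assms p_intros ptime_dcomplete ptime_dclosed ptime_dpath
    pdec_bex[where P = "\<lambda>e x. \<not> (deq (hd_data x) (hd_data e) \<or> deq (tl_data x) (hd_data e))"])

text \<open>One entry of \<open>B\<close> is dropped for each entry of \<open>A\<close>; something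
  remains exactly when \<open>B\<close> is the longer list.\<close>

definition dshorter :: "data \<Rightarrow> data \<Rightarrow> bool" where
  "dshorter A B \<longleftrightarrow> dfold (\<lambda>_. tl_data) A B \<noteq> Atom"

lemma pdec_dshorter:
  assumes "ptime A" "ptime B" shows "pdec (\<lambda>d. dshorter (A d) (B d))"
  unfolding dshorter_def
  by (rule pdec_nonAtom, rule ptime_dfold_const[where step = "\<lambda>_. tl_data" and p = "\<lambda>_. Atom" and r = "\<lambda>_. 0"])
    (simp add: size_tl_data | intro assms p_intros poly_bounded_const)+

definition dbest_step :: "data \<Rightarrow> data \<Rightarrow> data \<Rightarrow> data" where
  "dbest_step u e acc =
    (if acc = Atom \<or> dshorter (dcandidate (hd_data u) (tl_data u) e) acc
     then dcandidate (hd_data u) (tl_data u) e else acc)"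

definition dbest :: "data \<Rightarrow> data \<Rightarrow> data" where
  "dbest q X = dfold (dbest_step (Dot q X)) (tl_data q) Atom"

lemma ptime_dbest:
  assumes "ptime q" "ptime X" shows "ptime (\<lambda>d. dbest (q d) (X d))"
  unfolding dbest_def
proof (rule ptime_dfold[where step = dbest_step and
    r = "\<lambda>z. size (dcandidate (hd_data (hd_data z)) (tl_data (hd_data z)) (tl_data z))"])
  show "poly_bounded (\<lambda>z. size (dcandidate (hd_data (hd_data z)) (tl_data (hd_data z)) (tl_data z)))"
    by (intro ptime_size ptime_dcandidate p_intros)
  show "size (dbest_step u e acc) \<le> size acc +
      size (dcandidate (hd_data (hd_data (Dot u e))) (tl_data (hd_data (Dot u e))) (tl_data (Dot u e)))" for u e acc
    by (auto simp: dbest_step_def)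
qed (unfold dbest_step_def, (intro assms p_intros ptime_dcandidate pdec_dshorter)+)

definition ddarts :: "data \<Rightarrow> data" where
  "ddarts E = dfold (\<lambda>e acc. Dot e (Dot (Dot (tl_data e) (hd_data e)) acc)) E Atom"

lemma ptime_ddarts:
  assumes "ptime E" shows "ptime (\<lambda>d. ddarts (E d))"
  unfolding ddarts_def
proof (rule ptime_dfold[where p = "\<lambda>_. Atom" and r = "\<lambda>z. 3 * size z" and
    step = "\<lambda>_ e acc. Dot e (Dot (Dot (tl_data e) (hd_data e)) acc)"])
  show "poly_bounded (\<lambda>q. 3 * size q)"
    by (intro poly_bounded_mult poly_bounded_size poly_bounded_const)
  show "size (Dot e (Dot (Dot (tl_data e) (hd_data e)) acc)) \<le> size acc + 3 * size (Dot p e)" for p e acc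
    using size_hd_data[of e] size_tl_data[of e] by auto
qed (intro assms p_intros)+

definition dstar :: "data \<Rightarrow> data" where
  "dstar d = dbest (Dot (hd_data d) (ddarts (hd_data (tl_data d)))) (tl_data (tl_data d))"

lemma ptime_dstar: "ptime dstar"
  unfolding dstar_def by (intro ptime_dbest p_intros ptime_ddarts)

section \<open>The algorithm on lists\<close>

definition pick :: "('b \<Rightarrow> bool) \<Rightarrow> 'b list \<Rightarrow> 'b list \<Rightarrow> 'b list" where
  "pick P = fold (\<lambda>e acc. if P e then [e] else acc)"

text \<open>The last argument of \<open>pick\<close> is the fallback, so the outermost criterion has
  the highest priority. The current vertex \<open>hd p\<close> is adjacent to every candidate and is
  therefore excluded from the visited neighbours \<open>z\<close>.\<close>

definition path_choice :: "'a list \<Rightarrow> ('a \<times> 'a) set \<Rightarrow> 'a list \<Rightarrow> 'a list" where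
  "path_choice vs D p =
    pick (\<lambda>w. (hd p, w) \<in> D \<and> w \<notin> set p \<and> (\<exists>z\<in>set p. z \<noteq> hd p \<and> (z, w) \<in> D)) vs
     (pick (\<lambda>w. (hd p, w) \<in> D \<and> w \<notin> set p \<and> length (filter (\<lambda>z. (w, z) \<in> D) vs) \<le> 3) vs
       (pick (\<lambda>w. (hd p, w) \<in> D \<and> w \<notin> set p) vs []))"

definition path_step :: "'a list \<Rightarrow> ('a \<times> 'a) set \<Rightarrow> 'a list \<Rightarrow> 'a list" where
  "path_step vs D p = (case path_choice vs D p of [] \<Rightarrow> p | w # _ \<Rightarrow> w # p)"

definition greedy_path :: "'a list \<Rightarrow> ('a \<times> 'a) set \<Rightarrow> 'a \<Rightarrow> 'a \<Rightarrow> 'a list" where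
  "greedy_path vs D a b = fold (\<lambda>_. path_step vs D) vs [b, a]"

definition back_step :: "('a \<times> 'a) set \<Rightarrow> 'a list \<Rightarrow> 'a \<Rightarrow> 'a list \<Rightarrow> 'a list" where
  "back_step D p a r = (if hd r = a then r else
     case pick (\<lambda>w. (w, hd r) \<in> D) p [] of [] \<Rightarrow> r | w # _ \<Rightarrow> w # r)"

definition close_path :: "'a list \<Rightarrow> ('a \<times> 'a) set \<Rightarrow> 'a \<Rightarrow> 'a list \<Rightarrow> 'a list" where
  "close_path vs D a p = (if hd (fold (\<lambda>_. back_step D p a) vs p) = a
     then fold (\<lambda>_. back_step D p a) vs p else [a])"

definition insert_detour :: "'a \<Rightarrow> 'a \<Rightarrow> 'a list \<Rightarrow> 'a list" where
  "insert_detour u v W = fold (\<lambda>x acc. if x = u \<and> v \<notin> set acc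
     then u # v # x # acc else x # acc) W []"

definition complete_step :: "('a \<times> 'a) list \<Rightarrow> 'a list \<Rightarrow> 'a list" where
  "complete_step ds W = (case pick (\<lambda>e. fst e \<in> set W \<and> snd e \<notin> set W) ds []
     of [] \<Rightarrow> W | e # _ \<Rightarrow> insert_detour (fst e) (snd e) W)"

definition complete_walk :: "'a list \<Rightarrow> ('a \<times> 'a) list \<Rightarrow> 'a list \<Rightarrow> 'a list" where
  "complete_walk vs ds W = fold (\<lambda>_. complete_step ds) vs W"

definition candidate :: "'a list \<Rightarrow> ('a \<times> 'a) list \<Rightarrow> ('a \<times> 'a) list \<Rightarrow> 'a \<times> 'a \<Rightarrow> 'a list" where
  "candidate vs ds xs e = (if \<exists>x\<in>set xs. \<not> (fst x = fst e \<or> snd x = fst e)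
     then complete_walk vs ds (close_path vs (set ds) (fst e) (greedy_path vs (set ds) (fst e) (snd e)))
     else [fst e])"

definition best_candidate :: "'a list \<Rightarrow> ('a \<times> 'a) list \<Rightarrow> ('a \<times> 'a) list \<Rightarrow> 'a list" where
  "best_candidate vs ds xs = fold (\<lambda>e acc.
     if acc = [] \<or> length (candidate vs ds xs e) < length acc then candidate vs ds xs e else acc) ds []"

definition darts :: "('a \<times> 'a) list \<Rightarrow> ('a \<times> 'a) list" where
  "darts es = fold (\<lambda>e acc. e # (snd e, fst e) # acc) es []"

lemma pick_eq_Nil: "pick P xs [] = [] \<longleftrightarrow> (\<forall>x\<in>set xs. \<not> P x)"
proof -
  have "pick P xs acc = [] \<longleftrightarrow> (\<forall>x\<in>set xs. \<not> P x) \<and> acc = []" for acc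
    unfolding pick_def by (induction xs arbitrary: acc) auto
  then show ?thesis by simp
qed

lemma pick_cases: "pick P xs acc = acc \<and> (\<forall>x\<in>set xs. \<not> P x) \<or> (\<exists>x\<in>set xs. P x \<and> pick P xs acc = [x])"
proof (induction xs arbitrary: acc)
  case (Cons x xs)
  show ?case
    using Cons[of "if P x then [x] else acc"] by (auto simp: pick_def)
qed (simp add: pick_def)

lemma pick_Cons: "pick P xs acc = w # ws \<Longrightarrow> (w \<in> set xs \<and> P w) \<or> acc = w # ws"
  using pick_cases[of P xs acc] by auto

lemma pick_none: "(\<And>x. x \<in> set xs \<Longrightarrow> \<not> P x) \<Longrightarrow> pick P xs acc = acc"
  using pick_cases[of P xs acc] by auto

lemma pick_unique:
  assumes "w \<in> set xs" "P w" "\<And>x. x \<in> set xs \<Longrightarrow> P x \<Longrightarrow> x = w"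
  shows "pick P xs acc = [w]"
  using pick_cases[of P xs acc] assms by blast

lemma pick_last: "P w \<Longrightarrow> (\<And>x. x \<in> set ys \<Longrightarrow> \<not> P x) \<Longrightarrow> pick P (xs @ w # ys) acc = [w]"
  using pick_none[of ys P "[w]"] by (simp add: pick_def)

subsection \<open>The programs implement the list algorithm\<close>

abbreviation "enc \<equiv> enc_list enc_nat"

lemma dset_enc_list [simp]: "dset (enc_list f xs) = f ` set xs"
  by (induction xs) auto

lemma enc_list_eq_Atom [simp]: "enc_list f xs = Atom \<longleftrightarrow> xs = []"
  by (cases xs) auto

lemma hd_enc_list [simp]: "xs \<noteq> [] \<Longrightarrow> hd_data (enc_list f xs) = f (hd xs)"
  by (cases xs) auto

text \<open>Simulation of list folds by tree folds: \<open>g\<close> encodes accumulators, and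
  \<open>I\<close> carries what a single step needs, typically that the list is nonempty, so that
  \<open>hd_data\<close> really reads its head.\<close>

lemma dfold_enc_list:
  assumes "I a" "\<And>x a. x \<in> set xs \<Longrightarrow> I a \<Longrightarrow> F (f x) (g a) = g (G x a) \<and> I (G x a)"
  shows "dfold F (enc_list f xs) (g a) = g (fold G xs a)"
  using assms by (induction xs arbitrary: a) auto

lemma dpick_enc_list:
  assumes "\<And>x. x \<in> set xs \<Longrightarrow> P' (f x) \<longleftrightarrow> P x"
  shows "dpick P' (enc_list f xs) (enc_list f acc) = enc_list f (pick P xs acc)"
  unfolding dpick_def pick_def
  by (rule dfold_enc_list[where I = "\<lambda>_. True"]) (auto simp: assms)

lemma dpick_enc_eqI:
  assumes "acc' = enc_list f acc" "\<And>x. x \<in> set xs \<Longrightarrow> P' (f x) \<longleftrightarrow> P x"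
  shows "dpick P' (enc_list f xs) acc' = enc_list f (pick P xs acc)"
  unfolding assms(1) by (rule dpick_enc_list) (rule assms(2))

lemma dmem_enc [simp]: "dmem (enc_nat v) (enc xs) \<longleftrightarrow> v \<in> set xs"
  by (auto simp: dmem_def)

lemma dset_enc_edges [simp]: "dset (enc_edges es) = (\<lambda>(u, v). Dot (enc_nat u) (enc_nat v)) ` set es"
  by (simp add: enc_edges_def)

lemma dadj_enc [simp]: "dadj (enc_edges ds) (enc_nat a) (enc_nat b) \<longleftrightarrow> (a, b) \<in> set ds"
  by (force simp: dadj_def)

lemma dlow_degree_enc [simp]: "dlow_degree (enc vs) (enc_edges ds) (enc_nat w) \<longleftrightarrow>
    length (filter (\<lambda>z. (w, z) \<in> set ds) vs) \<le> 3"
proof -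
  have "fold (\<lambda>z acc. if (w, z) \<in> set ds then z # acc else acc) vs acc =
    rev (filter (\<lambda>z. (w, z) \<in> set ds) vs) @ acc" for acc
    by (induction vs arbitrary: acc) auto
  moreover have "dfold (\<lambda>z acc. if dadj (enc_edges ds) (enc_nat w) z then Dot Atom acc else acc) (enc vs)
      (enc_list (\<lambda>_. Atom) ([] :: nat list)) =
      enc_list (\<lambda>_. Atom) (fold (\<lambda>z acc. if (w, z) \<in> set ds then z # acc else acc) vs [])"
    by (rule dfold_enc_list[where I = "\<lambda>_. True" and g = "enc_list (\<lambda>_. Atom)"]) auto
  moreover have "tl_data (tl_data (tl_data (enc_list (\<lambda>_. Atom) ys))) = Atom \<longleftrightarrow> length ys \<le> 3" for ys :: "nat list"
    by (cases ys; cases "tl ys"; cases "tl (tl ys)") auto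
  ultimately show ?thesis by (simp add: dlow_degree_def)
qed

lemma dpath_choice_enc:
  assumes "p \<noteq> []"
  shows "dpath_choice (Dot (enc vs) (enc_edges ds)) (enc p) = enc (path_choice vs (set ds) p)"
  unfolding dpath_choice_def path_choice_def hd_data.simps tl_data.simps
  by (intro dpick_enc_eqI) (use assms in simp_all)

lemma dpath_step_enc:
  assumes "p \<noteq> []"
  shows "dpath_step (Dot (enc vs) (enc_edges ds)) (enc p) = enc (path_step vs (set ds) p)"
  unfolding dpath_step_def path_step_def dpath_choice_enc[OF assms]
  by (cases "path_choice vs (set ds) p") auto

lemma path_step_nonempty: "p \<noteq> [] \<Longrightarrow> path_step vs D p \<noteq> []"
  by (auto simp: path_step_def split: list.split)

lemma fold_nonempty: "(\<And>x p. p \<noteq> [] \<Longrightarrow> f x p \<noteq> []) \<Longrightarrow> p \<noteq> [] \<Longrightarrow> fold f xs p \<noteq> []"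
  by (induction xs arbitrary: p) auto

lemma greedy_path_nonempty: "greedy_path vs D a b \<noteq> []"
  unfolding greedy_path_def by (rule fold_nonempty) (auto simp: path_step_nonempty)

lemma dpath_enc:
  "dpath (Dot (enc vs) (enc_edges ds)) (enc_nat a) (enc_nat b) = enc (greedy_path vs (set ds) a b)"
  unfolding dpath_def greedy_path_def
  using dfold_enc_list[where I = "\<lambda>p. p \<noteq> []" and g = enc and a = "[b, a]" and f = enc_nat and xs = vs
      and F = "\<lambda>_. dpath_step (Dot (enc vs) (enc_edges ds))" and G = "\<lambda>_. path_step vs (set ds)"]
  by (simp add: dpath_step_enc path_step_nonempty)

lemma back_step_nonempty: "r \<noteq> [] \<Longrightarrow> back_step D p a r \<noteq> []"
  by (auto simp: back_step_def split: list.split)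

lemma dback_step_enc:
  assumes "r \<noteq> []"
  shows "dback_step (enc_edges ds) (enc p) (enc_nat a) (enc r) = enc (back_step (set ds) p a r)"
proof -
  have "dpick (\<lambda>w. dadj (enc_edges ds) w (hd_data (enc r))) (enc p) Atom =
    enc (pick (\<lambda>w. (w, hd r) \<in> set ds) p [])"
    by (subst dpick_enc_list[where acc = "[]", simplified]) (use assms in auto)
  then show ?thesis
    using assms unfolding dback_step_def back_step_def
    by (cases "pick (\<lambda>w. (w, hd r) \<in> set ds) p []") auto
qed

lemma dclosed_enc:
  assumes "p \<noteq> []"
  shows "dclosed (Dot (enc vs) (enc_edges ds)) (enc_nat a) (enc p) = enc (close_path vs (set ds) a p)"
proof -
  have "dfold (\<lambda>_. dback_step (enc_edges ds) (enc p) (enc_nat a)) (enc vs) (enc p) =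
    enc (fold (\<lambda>_. back_step (set ds) p a) vs p)"
    by (rule dfold_enc_list[where I = "\<lambda>p. p \<noteq> []" and g = enc])
      (auto simp: assms dback_step_enc back_step_nonempty)
  moreover have "fold (\<lambda>_. back_step (set ds) p a) vs p \<noteq> []"
    by (rule fold_nonempty) (auto simp: assms back_step_nonempty)
  ultimately show ?thesis by (simp add: dclosed_def close_path_def)
qed

lemma dinsert_enc:
  "dinsert (Dot (enc_nat u) (enc_nat v)) (enc W) = enc (insert_detour u v W)"
  unfolding dinsert_def insert_detour_def
  using dfold_enc_list[where I = "\<lambda>p. True" and g = enc and a = "[]" and f = enc_nat and xs = W
      and F = "dinsert_step (Dot (enc_nat u) (enc_nat v))" and
      G = "\<lambda>x acc. if x = u \<and> v \<notin> set acc then u # v # x # acc else x # acc"]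
  by (simp add: dinsert_step_def)

lemma dcomplete_step_enc: "dcomplete_step (enc_edges ds) (enc W) = enc (complete_step ds W)"
proof -
  have "dpick (\<lambda>e. dmem (hd_data e) (enc W) \<and> \<not> dmem (tl_data e) (enc W)) (enc_edges ds) Atom =
    enc_edges (pick (\<lambda>e. fst e \<in> set W \<and> snd e \<notin> set W) ds [])"
    unfolding enc_edges_def by (subst dpick_enc_list[where acc = "[]", simplified]) auto
  then show ?thesis
    unfolding dcomplete_step_def complete_step_def
    by (cases "pick (\<lambda>e. fst e \<in> set W \<and> snd e \<notin> set W) ds []")
      (auto simp: enc_edges_def dinsert_enc)
qed

lemma dcomplete_enc:
  "dcomplete (Dot (enc vs) (enc_edges ds)) (enc W) = enc (complete_walk vs ds W)"
  unfolding dcomplete_def complete_walk_def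
  using dfold_enc_list[where I = "\<lambda>p. True" and g = enc and a = W and f = enc_nat and xs = vs
      and F = "\<lambda>_. dcomplete_step (enc_edges ds)" and G = "\<lambda>_. complete_step ds"]
  by (simp add: dcomplete_step_enc)

lemma dcandidate_enc:
  "dcandidate (Dot (enc vs) (enc_edges ds)) (enc_edges xs) (Dot (enc_nat a) (enc_nat b)) =
    enc (candidate vs ds xs (a, b))"
  unfolding dcandidate_def candidate_def
  by (auto simp: dpath_enc dclosed_enc dcomplete_enc greedy_path_nonempty split_beta)

lemma dshorter_enc: "dshorter (enc_list f xs) (enc_list g ys) \<longleftrightarrow> length xs < length ys"
proof -
  have "dfold (\<lambda>_. tl_data) (enc_list f xs) (enc_list g ys) = enc_list g (drop (length xs) ys)"
  proof (induction xs arbitrary: ys)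
    case (Cons x xs)
    have "dfold (\<lambda>_. tl_data) xs' Atom = Atom" for xs'
      by (induction xs') auto
    with Cons show ?case by (cases ys) auto
  qed simp
  then show ?thesis by (simp add: dshorter_def not_le)
qed

lemma dbest_enc:
  "dbest (Dot (enc vs) (enc_edges ds)) (enc_edges xs) = enc (best_candidate vs ds xs)"
proof -
  have "dfold (dbest_step (Dot (Dot (enc vs) (enc_edges ds)) (enc_edges xs))) (enc_edges ds) (enc []) =
    enc (best_candidate vs ds xs)"
    unfolding best_candidate_def
    by (subst (2) enc_edges_def, rule dfold_enc_list[where I = "\<lambda>_. True" and g = enc])
      (auto simp: dbest_step_def dcandidate_enc dshorter_enc)
  then show ?thesis by (simp add: dbest_def)
qed

lemma ddarts_enc: "ddarts (enc_edges es) = enc_edges (darts es)"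
proof -
  have "dfold (\<lambda>e acc. Dot e (Dot (Dot (tl_data e) (hd_data e)) acc)) (enc_edges es) (enc_edges []) =
    enc_edges (darts es)"
    unfolding darts_def unfolding enc_edges_def
    by (rule dfold_enc_list[where I = "\<lambda>_. True"]) auto
  then show ?thesis by (simp add: ddarts_def enc_edges_def)
qed

lemma dstar_enc:
  "dstar (Dot (enc vs) (Dot (enc_edges es) (enc_edges xs))) = enc_walk (best_candidate vs (darts es) xs)"
  by (simp add: dstar_def ddarts_enc dbest_enc enc_walk_def)

lemma set_darts: "set (darts es) = set es \<union> (\<lambda>e. (snd e, fst e)) ` set es"
proof -
  have "set (fold (\<lambda>e acc. e # (snd e, fst e) # acc) es acc) =
    set es \<union> (\<lambda>e. (snd e, fst e)) ` set es \<union> set acc" for acc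
    by (induction es arbitrary: acc) auto
  then show ?thesis by (simp add: darts_def)
qed

section \<open>Correctness\<close>

lemma fold_const: "fold (\<lambda>_. f) xs = f ^^ length xs"
  by (induction xs) (auto simp: funpow_Suc_right simp del: funpow.simps)

lemma funpow_invariant: "I a \<Longrightarrow> (\<And>a. I a \<Longrightarrow> I (f a)) \<Longrightarrow> I ((f ^^ k) a)"
  by (induction k) auto

lemma funpow_growth:
  fixes \<mu> :: "'b \<Rightarrow> nat"
  assumes "\<And>a. \<mu> (f a) \<le> \<mu> a + c" shows "\<mu> ((f ^^ k) a) \<le> \<mu> a + k * c"
proof (induction k)
  case (Suc k)
  then show ?case using assms[of "(f ^^ k) a"] by simp
qed simp

section \<open>Closed walks in a connected graph\<close>

locale connected_darts =
  fixes vs :: "'a list" and ds :: "('a \<times> 'a) list"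
  assumes distinct: "distinct vs"
    and sym: "(a, b) \<in> set ds \<Longrightarrow> (b, a) \<in> set ds"
    and verts: "(a, b) \<in> set ds \<Longrightarrow> a \<in> set vs \<and> b \<in> set vs"
    and connected: "S \<subseteq> set vs \<Longrightarrow> S \<noteq> {} \<Longrightarrow> S \<noteq> set vs \<Longrightarrow> \<exists>a b. (a, b) \<in> set ds \<and> a \<in> S \<and> b \<notin> S"
begin

definition is_walk :: "'a list \<Rightarrow> bool" where
  "is_walk p \<longleftrightarrow> p \<noteq> [] \<and> set p \<subseteq> set vs \<and> successively (\<lambda>a b. (a, b) \<in> set ds) p"

lemma path_choice_cand:
  "path_choice vs (set ds) p = w # ws \<Longrightarrow> (hd p, w) \<in> set ds \<and> w \<notin> set p"
  unfolding path_choice_def by (auto dest!: pick_Cons)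

lemma is_walk_Cons: "is_walk p \<Longrightarrow> (w, hd p) \<in> set ds \<Longrightarrow> is_walk (w # p)"
  using verts by (cases p) (auto simp: is_walk_def)

lemma path_step_walk:
  assumes "is_walk p \<and> distinct p \<and> last p = a"
  shows "is_walk (path_step vs (set ds) p) \<and> distinct (path_step vs (set ds) p) \<and>
    last (path_step vs (set ds) p) = a"
  using assms path_choice_cand[of p]
  by (auto simp: path_step_def split: list.split intro: is_walk_Cons sym) (auto simp: is_walk_def)

lemma greedy_path_walk:
  assumes "(a, b) \<in> set ds" "a \<noteq> b"
  shows "is_walk (greedy_path vs (set ds) a b) \<and> distinct (greedy_path vs (set ds) a b) \<and>
    last (greedy_path vs (set ds) a b) = a"
  unfolding greedy_path_def fold_const
  by (rule funpow_invariant[where I = "\<lambda>p. is_walk p \<and> distinct p \<and> last p = a"])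
    (use assms verts sym path_step_walk in \<open>auto simp: is_walk_def\<close>)

lemma length_greedy_path: "length (greedy_path vs (set ds) a b) \<le> length vs + 2"
proof -
  have "length (path_step vs (set ds) p) \<le> length p + 1" for p
    by (auto simp: path_step_def split: list.split)
  from funpow_growth[of length, OF this] show ?thesis
    unfolding greedy_path_def fold_const by (metis length_Cons list.size(3) mult.right_neutral numeral_2_eq_2 add.commute)
qed

lemma back_step_walk:
  "is_walk r \<and> last r = a \<Longrightarrow> is_walk (back_step (set ds) p a r) \<and> last (back_step (set ds) p a r) = a"
  by (auto simp: back_step_def split: list.split dest: pick_Cons intro: is_walk_Cons) (auto simp: is_walk_def)

lemma close_path_walk:
  assumes "is_walk p" "last p = a"
  shows "is_walk (close_path vs (set ds) a p) \<and> last (close_path vs (set ds) a p) = a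
    \<and> hd (close_path vs (set ds) a p) = a"
proof -
  have "is_walk (fold (\<lambda>_. back_step (set ds) p a) vs p) \<and> last (fold (\<lambda>_. back_step (set ds) p a) vs p) = a"
    unfolding fold_const
    by (rule funpow_invariant[where I = "\<lambda>r. is_walk r \<and> last r = a"]) (auto simp: assms back_step_walk)
  moreover have "a \<in> set vs" using assms by (auto simp: is_walk_def)
  ultimately show ?thesis by (auto simp: close_path_def is_walk_def)
qed

lemma length_close_path:
  "length (close_path vs (set ds) a p) \<le> max 1 (length p + length vs)"
proof -
  have "length (back_step (set ds) p a r) \<le> length r + 1" for r
    by (auto simp: back_step_def split: list.split)
  from funpow_growth[of length, OF this] show ?thesis
    unfolding close_path_def fold_const
    by (auto simp: max.coboundedI2)
qed

definition closed :: "'a list \<Rightarrow> bool" where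
  "closed W \<longleftrightarrow> is_walk W \<and> hd W = last W"

lemma insert_detour_eq:
  assumes "u \<in> set W" "v \<notin> set W"
  obtains xs ys where "W = xs @ u # ys" "insert_detour u v W = rev (xs @ u # v # u # ys)"
proof -
  obtain xs ys where W: "W = xs @ u # ys" "u \<notin> set xs" using split_list_first[OF assms(1)] by blast
  let ?f = "\<lambda>x acc. if x = u \<and> v \<notin> set acc then u # v # x # acc else x # acc"
  have 1: "fold ?f xs acc = rev xs @ acc" if "u \<notin> set xs" for xs acc
    using that by (induction xs arbitrary: acc) auto
  have 2: "fold ?f ys acc = rev ys @ acc" if "v \<in> set acc" for ys acc
    using that by (induction ys arbitrary: acc) auto
  have "v \<notin> set (rev xs)" using assms W by auto
  then have "insert_detour u v W = rev (xs @ u # v # u # ys)"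
    using W 1[OF W(2), of "[]"] 2[of "u # v # u # rev xs" ys] by (simp add: insert_detour_def)
  with W show ?thesis using that by blast
qed

text \<open>The trip \<open>u\<close>, \<open>v\<close>, \<open>u\<close> uses a dart and its
  reverse. The fold also reverses the whole walk, which is harmless because the set of darts is
  symmetric.\<close>

lemma insert_detour_closed:
  assumes "closed W" "u \<in> set W" "v \<notin> set W" "(u, v) \<in> set ds"
  shows "closed (insert_detour u v W)" "set (insert_detour u v W) = insert v (set W)"
proof -
  obtain xs ys where W: "W = xs @ u # ys" "insert_detour u v W = rev (xs @ u # v # u # ys)"
    using insert_detour_eq[OF assms(2,3)] by blast
  have "successively (\<lambda>a b. (a, b) \<in> set ds) (xs @ u # v # u # ys)"
    using assms W(1) sym by (auto simp: closed_def is_walk_def successively_append_iff)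
  then have "successively (\<lambda>a b. (a, b) \<in> set ds) (rev (xs @ u # v # u # ys))"
    unfolding successively_rev by (rule successively_mono) (auto intro: sym)
  moreover have "hd (insert_detour u v W) = last W" "last (insert_detour u v W) = hd W"
    unfolding W(2) hd_rev last_rev using W(1) by (auto simp: hd_append)
  moreover have "set (insert_detour u v W) \<subseteq> set vs" "insert_detour u v W \<noteq> []"
    using assms W verts by (auto simp: closed_def is_walk_def)
  ultimately show "closed (insert_detour u v W)"
    using assms(1) W(2) unfolding closed_def is_walk_def by metis
  show "set (insert_detour u v W) = insert v (set W)" using W by auto
qed

text \<open>If no dart leaves the vertex set of \<open>W\<close>, the cut condition
  \<open>connected\<close> forces that set to be everything; otherwise the detour adds exactly one
  vertex.\<close>

lemma complete_step_cases:
  assumes "closed W"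
  shows "set W = set vs \<and> complete_step ds W = W \<or>
    closed (complete_step ds W) \<and> card (set (complete_step ds W)) = Suc (card (set W))"
proof (cases "pick (\<lambda>e. fst e \<in> set W \<and> snd e \<notin> set W) ds []")
  case Nil
  then have "\<not> (\<exists>a b. (a, b) \<in> set ds \<and> a \<in> set W \<and> b \<notin> set W)"
    unfolding pick_eq_Nil by auto
  then have "set W = set vs"
    using connected[of "set W"] assms by (auto simp: closed_def is_walk_def)
  then show ?thesis using Nil by (simp add: complete_step_def)
next
  case (Cons e es)
  then have "e \<in> set ds" "fst e \<in> set W" "snd e \<notin> set W" using pick_Cons by fastforce+
  then show ?thesis
    using insert_detour_closed[OF assms, of "fst e" "snd e"] Cons by (simp add: complete_step_def)
qed

lemma length_complete_step: "length (complete_step ds W) \<le> length W + 2"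
proof (cases "pick (\<lambda>e. fst e \<in> set W \<and> snd e \<notin> set W) ds []")
  case (Cons e es)
  then have "fst e \<in> set W" "snd e \<notin> set W" using pick_Cons by fastforce+
  then obtain xs ys where "W = xs @ fst e # ys" "insert_detour (fst e) (snd e) W = rev (xs @ fst e # snd e # fst e # ys)"
    using insert_detour_eq[of "fst e" W "snd e"] by metis
  then show ?thesis using Cons by (auto simp: complete_step_def)
qed (simp add: complete_step_def)

lemma complete_walk_closed:
  assumes "closed W"
  shows "closed (complete_walk vs ds W)" "set (complete_walk vs ds W) = set vs"
proof -
  \<comment> \<open>An incomplete walk has more than \<open>k\<close> vertices after
    \<open>k\<close> rounds, so \<open>length vs\<close> rounds must complete it.\<close>
  have *: "closed ((complete_step ds ^^ k) W) \<and>
    (set ((complete_step ds ^^ k) W) = set vs \<or> k < card (set ((complete_step ds ^^ k) W)))" for k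
  proof (induction k)
    case 0
    then show ?case using assms by (auto simp: closed_def is_walk_def card_gt_0_iff)
  next
    case (Suc k)
    define U where "U = (complete_step ds ^^ k) W"
    have U: "closed U" "set U = set vs \<or> k < card (set U)" using Suc by (auto simp: U_def)
    have le: "card (set (complete_step ds U)) \<le> card (set vs)" if "closed (complete_step ds U)"
      using that by (intro card_mono) (auto simp: closed_def is_walk_def)
    from complete_step_cases[OF U(1)]
    have "closed (complete_step ds U) \<and>
      (set (complete_step ds U) = set vs \<or> Suc k < card (set (complete_step ds U)))"
    proof (elim disjE conjE)
      assume "set U = set vs" "complete_step ds U = U"
      then show ?thesis using U(1) by metis
    next
      assume "closed (complete_step ds U)" "card (set (complete_step ds U)) = Suc (card (set U))"
      moreover from this have "set U \<noteq> set vs" using le by (metis Suc_n_not_le_n)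
      ultimately show ?thesis using U(2) by simp
    qed
    then show ?case by (simp add: U_def)
  qed
  have "card (set ((complete_step ds ^^ length vs) W)) \<le> card (set vs)"
    using *[of "length vs"] by (intro card_mono) (auto simp: closed_def is_walk_def)
  then show "closed (complete_walk vs ds W)" "set (complete_walk vs ds W) = set vs"
    using *[of "length vs"] distinct_card[OF distinct] by (auto simp: complete_walk_def fold_const)
qed

lemma complete_walk_idle:
  assumes "closed W" "set W = set vs" shows "complete_walk vs ds W = W"
proof -
  have "complete_step ds W = W"
    using complete_step_cases[OF assms(1)] assms(2) card_mono[of "set vs" "set (complete_step ds W)"]
    by (auto simp: closed_def is_walk_def)
  then show ?thesis unfolding complete_walk_def fold_const
    by - (rule funpow_invariant[where I = "\<lambda>W'. W' = W"], auto)
qed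

lemma length_complete_walk: "length (complete_walk vs ds W) \<le> length W + 2 * length vs"
  using funpow_growth[of length "complete_step ds" 2, OF length_complete_step, of "length vs" W]
  by (simp add: complete_walk_def fold_const mult.commute)

text \<open>The length bound adds \<open>length vs + 2\<close> for the greedy path,
  \<open>length vs\<close> for the way back and \<open>2 * length vs\<close> for detours. It holds
  for every starting edge and is the bound used for narrow grids.\<close>

lemma candidate_closed:
  assumes "e \<in> set ds" "fst e \<noteq> snd e"
  shows "closed (candidate vs ds xs e)"
    "(\<forall>x\<in>set xs. fst x = fst e \<or> snd x = fst e) \<and> candidate vs ds xs e = [fst e] \<or>
     set (candidate vs ds xs e) = set vs"
    "length (candidate vs ds xs e) \<le> 4 * length vs + 2"
proof -
  define p where "p = greedy_path vs (set ds) (fst e) (snd e)"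
  define c where "c = close_path vs (set ds) (fst e) p"
  have cand: "candidate vs ds xs e = (if \<exists>x\<in>set xs. \<not> (fst x = fst e \<or> snd x = fst e)
     then complete_walk vs ds c else [fst e])"
    by (simp only: candidate_def p_def c_def)
  have "is_walk p \<and> distinct p \<and> last p = fst e"
    unfolding p_def by (rule greedy_path_walk) (use assms in auto)
  then have c: "closed c" using close_path_walk[of p "fst e"] by (auto simp: closed_def c_def)
  have "fst e \<in> set vs" using verts[of "fst e" "snd e"] assms(1) by simp
  then show "closed (candidate vs ds xs e)"
    using complete_walk_closed(1)[OF c] by (simp add: cand closed_def is_walk_def)
  show "(\<forall>x\<in>set xs. fst x = fst e \<or> snd x = fst e) \<and> candidate vs ds xs e = [fst e] \<or>
     set (candidate vs ds xs e) = set vs"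
    using complete_walk_closed(2)[OF c] by (simp add: cand)
  show "length (candidate vs ds xs e) \<le> 4 * length vs + 2"
  proof -
    have "length p \<le> length vs + 2" unfolding p_def by (rule length_greedy_path)
    then have "length c \<le> 2 * length vs + 2"
      using length_close_path[of "fst e" p] by (simp add: c_def)
    then show ?thesis using length_complete_walk[of c] by (simp add: cand)
  qed
qed

end

section \<open>Selecting a shortest candidate\<close>

lemma fold_best:
  assumes "acc \<noteq> []" "\<And>e. e \<in> set es \<Longrightarrow> c e \<noteq> []"
    and b: "b = fold (\<lambda>e acc. if acc = [] \<or> length (c e) < length acc then c e else acc) es acc"
  shows "(b = acc \<or> b \<in> c ` set es) \<and> length b \<le> length acc \<and> (\<forall>e\<in>set es. length b \<le> length (c e))"
  using assms
proof (induction es arbitrary: acc)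
  case (Cons e es)
  let ?a = "if acc = [] \<or> length (c e) < length acc then c e else acc"
  have "(b = ?a \<or> b \<in> c ` set es) \<and> length b \<le> length ?a \<and> (\<forall>e\<in>set es. length b \<le> length (c e))"
    by (rule Cons.IH) (use Cons.prems in \<open>simp_all\<close>)
  then show ?case using Cons.prems(1) by (auto split: if_splits)
qed simp

lemma best_candidate:
  assumes "ds \<noteq> []" "\<And>e. e \<in> set ds \<Longrightarrow> candidate vs ds xs e \<noteq> []"
  shows "best_candidate vs ds xs \<in> candidate vs ds xs ` set ds"
    "e \<in> set ds \<Longrightarrow> length (best_candidate vs ds xs) \<le> length (candidate vs ds xs e)"
proof -
  define c where "c = candidate vs ds xs"
  define b where "b = best_candidate vs ds xs"
  obtain e0 es where ds: "ds = e0 # es" using assms(1) by (cases ds) auto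
  have "b = fold (\<lambda>e acc. if acc = [] \<or> length (c e) < length acc then c e else acc) es (c e0)"
    unfolding b_def best_candidate_def c_def[symmetric] using ds by simp
  moreover have "\<And>e. e \<in> set ds \<Longrightarrow> c e \<noteq> []" using assms(2) by (simp add: c_def)
  ultimately have "(b = c e0 \<or> b \<in> c ` set es) \<and> length b \<le> length (c e0) \<and>
      (\<forall>e\<in>set es. length b \<le> length (c e))"
    using ds by (intro fold_best) auto
  then show "best_candidate vs ds xs \<in> candidate vs ds xs ` set ds"
    "e \<in> set ds \<Longrightarrow> length (best_candidate vs ds xs) \<le> length (candidate vs ds xs e)"
    using ds by (auto simp: b_def c_def)
qed

subsection \<open>Grids\<close>

definition grid_adj :: "nat \<times> nat \<Rightarrow> nat \<times> nat \<Rightarrow> bool" where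
  "grid_adj p q \<longleftrightarrow> fst p = fst q \<and> (snd q = Suc (snd p) \<or> snd p = Suc (snd q)) \<or>
     snd p = snd q \<and> (fst q = Suc (fst p) \<or> fst p = Suc (fst q))"

lemma grid_adj_sym: "grid_adj p q \<Longrightarrow> grid_adj q p"
  by (auto simp: grid_adj_def)

text \<open>The coordinates given by \<open>f\<close> exist only in the analysis; the algorithm sees
  nothing but \<open>vs\<close> and \<open>ds\<close>.\<close>

locale labelled_grid =
  fixes n m :: nat and f :: "nat \<times> nat \<Rightarrow> 'a" and vs :: "'a list" and ds :: "('a \<times> 'a) list"
  assumes pos: "n \<ge> 1" "m \<ge> 1"
    and bij: "bij_betw f ({..<n} \<times> {..<m}) (set vs)"
    and distinct_vs: "distinct vs"
    and set_ds: "set ds = {(f p, f q) | p q. p \<in> {..<n} \<times> {..<m} \<and> q \<in> {..<n} \<times> {..<m} \<and> grid_adj p q}"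
begin

definition "Grid = {..<n} \<times> {..<m}"

lemma Grid_iff [simp]: "(i, j) \<in> Grid \<longleftrightarrow> i < n \<and> j < m"
  by (simp add: Grid_def)

lemma finite_Grid [simp]: "finite Grid" and card_Grid: "card Grid = n * m"
  by (simp_all add: Grid_def)

lemma inj: "p \<in> Grid \<Longrightarrow> q \<in> Grid \<Longrightarrow> f p = f q \<longleftrightarrow> p = q"
  using bij unfolding bij_betw_def Grid_def by (meson inj_on_eq_iff)

lemma inj_on_Grid: "inj_on f Grid" using bij by (simp add: bij_betw_def Grid_def)

lemma set_vs: "set vs = f ` Grid"
  using bij by (simp add: bij_betw_def Grid_def)

lemma length_vs: "length vs = n * m"
  using distinct_card[OF distinct_vs] card_image[OF inj_on_Grid] card_Grid set_vs by simp

lemma adj_iff: "p \<in> Grid \<Longrightarrow> q \<in> Grid \<Longrightarrow> (f p, f q) \<in> set ds \<longleftrightarrow> grid_adj p q"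
  unfolding set_ds Grid_def[symmetric] using inj by blast

lemma mem_image: "p \<in> Grid \<Longrightarrow> S \<subseteq> Grid \<Longrightarrow> f p \<in> f ` S \<longleftrightarrow> p \<in> S"
  using inj by blast

text \<open>From any cell of \<open>S\<close>, going up and left reaches the corner
  \<open>(0, 0)\<close>, and from the corner every cell is reached along the first column and then
  along a row. Truncated subtraction keeps the moves up and left inside the grid.\<close>

lemma grid_connected:
  assumes "S \<subseteq> Grid" "S \<noteq> {}" "\<And>p q. p \<in> S \<Longrightarrow> q \<in> Grid \<Longrightarrow> grid_adj p q \<Longrightarrow> q \<in> S"
  shows "S = Grid"
proof -
  have up: "(i, j) \<in> S \<Longrightarrow> (i - k, j) \<in> S" for i j k
  proof (induction k)
    case (Suc k)
    then have "(i - k, j) \<in> S" by simp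
    moreover from this have "(i - k, j) \<in> Grid" using assms(1) by blast
    then have "i - Suc k < n" "j < m" by auto
    ultimately show ?case using assms(3)[of "(i - k, j)" "(i - Suc k, j)"]
      by (cases "k < i") (auto simp: grid_adj_def Suc_diff_Suc)
  qed simp
  have left: "(i, j) \<in> S \<Longrightarrow> (i, j - k) \<in> S" for i j k
  proof (induction k)
    case (Suc k)
    then have "(i, j - k) \<in> S" by simp
    moreover from this have "(i, j - k) \<in> Grid" using assms(1) by blast
    then have "i < n" "j - Suc k < m" by auto
    ultimately show ?case using assms(3)[of "(i, j - k)" "(i, j - Suc k)"]
      by (cases "k < j") (auto simp: grid_adj_def Suc_diff_Suc)
  qed simp
  have 0: "(0, 0) \<in> S"
  proof -
    obtain i j where "(i, j) \<in> S" using assms(2) by fastforce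
    from left[OF up[OF this, of i], of j] show ?thesis by simp
  qed
  have down: "(i, 0) \<in> S" if "i < n" for i
    using that
  proof (induction i)
    case (Suc i)
    then show ?case using assms(3)[of "(i, 0)" "(Suc i, 0)"] pos by (auto simp: grid_adj_def)
  qed (rule 0)
  have "(i, j) \<in> S" if "i < n" "j < m" for i j
    using that
  proof (induction j)
    case (Suc j)
    then show ?case using assms(3)[of "(i, j)" "(i, Suc j)"] by (auto simp: grid_adj_def)
  qed (use down in simp)
  then show ?thesis using assms(1) by auto
qed

sublocale connected_darts vs ds
proof
  show "distinct vs" by (rule distinct_vs)
  show "(a, b) \<in> set ds \<Longrightarrow> (b, a) \<in> set ds" for a b
    unfolding set_ds using grid_adj_sym by blast
  show "(a, b) \<in> set ds \<Longrightarrow> a \<in> set vs \<and> b \<in> set vs" for a b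
    unfolding set_ds set_vs Grid_def[symmetric] by blast
  show "\<exists>a b. (a, b) \<in> set ds \<and> a \<in> S \<and> b \<notin> S"
    if S: "S \<subseteq> set vs" "S \<noteq> {}" "S \<noteq> set vs" for S
  proof (rule ccontr)
    assume "\<not> ?thesis"
    then have "{p \<in> Grid. f p \<in> S} = Grid"
      using S(1,2) adj_iff by (intro grid_connected) (auto simp: set_vs)
    then show False using S by (auto simp: set_vs)
  qed
qed

lemma degree:
  assumes "p \<in> Grid"
  shows "length (filter (\<lambda>z. (f p, z) \<in> set ds) vs) = card {q \<in> Grid. grid_adj p q}"
proof -
  have "length (filter (\<lambda>z. (f p, z) \<in> set ds) vs) = card (set (filter (\<lambda>z. (f p, z) \<in> set ds) vs))"
    by (metis distinct_card distinct_filter distinct_vs)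
  also have "set (filter (\<lambda>z. (f p, z) \<in> set ds) vs) = f ` {q \<in> Grid. grid_adj p q}"
    unfolding set_filter set_vs using adj_iff[OF assms] by blast
  also have "card \<dots> = card {q \<in> Grid. grid_adj p q}"
    by (rule card_image) (rule inj_on_subset[OF inj_on_Grid], auto)
  finally show ?thesis .
qed

subsection \<open>The greedy path from a corner of the grid is a snake\<close>

text \<open>The cells visited by the time the snake stands on \<open>(i, j)\<close>: all columns
  before \<open>j\<close>, and the part of column \<open>j\<close> already traversed, with growing
  row index in even columns and falling row index in odd ones.\<close>

fun snake_upto :: "nat \<times> nat \<Rightarrow> (nat \<times> nat) set" where
  "snake_upto (i, j) = {(a, b). a < n \<and> (b < j \<or> b = j \<and> (if even j then a \<le> i else i \<le> a))}"

fun snake_next :: "nat \<times> nat \<Rightarrow> nat \<times> nat" where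
  "snake_next (i, j) = (if even j then if Suc i < n then (Suc i, j) else (i, Suc j)
     else if i > 0 then (i - 1, j) else (i, Suc j))"

fun snake_end :: "nat \<times> nat \<Rightarrow> bool" where
  "snake_end (i, j) \<longleftrightarrow> Suc j = m \<and> (if even j then Suc i = n else i = 0)"

declare snake_upto.simps [simp del] snake_next.simps [simp del] snake_end.simps [simp del]

lemma snake_upto_subset: "v \<in> Grid \<Longrightarrow> snake_upto v \<subseteq> Grid"
  by (cases v) (auto simp: snake_upto.simps)

lemma snake_next_Grid: "v \<in> Grid \<Longrightarrow> \<not> snake_end v \<Longrightarrow> snake_next v \<in> Grid"
  by (cases v) (auto simp: snake_next.simps snake_end.simps split: if_splits)

lemma snake_upto_next:
  "v \<in> Grid \<Longrightarrow> snake_upto (snake_next v) = insert (snake_next v) (snake_upto v)"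
  by (cases v) (auto simp: snake_next.simps snake_upto.simps elim!: less_SucE)

lemma snake_next_notin: "v \<in> Grid \<Longrightarrow> snake_next v \<notin> snake_upto v"
  by (cases v) (auto simp: snake_next.simps snake_upto.simps)

lemma snake_end_upto: "v \<in> Grid \<Longrightarrow> snake_end v \<Longrightarrow> snake_upto v = Grid"
  by (cases v) (auto simp: snake_end.simps snake_upto.simps Grid_def split: if_splits)

lemma grid_adj_snake_next: "v \<in> Grid \<Longrightarrow> grid_adj v (snake_next v)"
  by (cases v) (auto simp: snake_next.simps grid_adj_def)

text \<open>The successor on the snake has only one possible competitor, the cell in the next
  column. The preferences of the greedy rule serve to reject it.\<close>

lemma unvisited_neighbour:
  assumes "v \<in> Grid" "x \<in> Grid" "grid_adj v x" "x \<notin> snake_upto v"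
  shows "x = snake_next v \<or> x = (fst v, Suc (snd v))"
  using assms
  by (cases v; cases x) (auto simp: snake_next.simps snake_upto.simps grid_adj_def split: if_splits)

lemma card_le_3: "card {a, b, c} \<le> 3"
  by (simp add: card_insert_if)

text \<open>At a turn the next column offers the only candidate. Inside a later column the successor
  touches the completed column before it, whereas the competitor touches no visited cell but
  \<open>v\<close>. In column 0 neither touches another visited cell, and the degree decides: the
  successor lies on the side, the competitor in the interior. At \<open>(0, 0)\<close> both
  neighbours have degree 3 and nothing decides, which is why the path starts with an edge rather
  than a vertex.\<close>

lemma path_choice_snake:
  assumes n: "n \<ge> 3" and m: "m \<ge> 3" and v: "v \<in> Grid" "\<not> snake_end v" "v \<noteq> (0, 0)"
    and q: "q \<noteq> []" "hd q = v" "set q = snake_upto v"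
  shows "path_choice vs (set ds) (map f q) = [f (snake_next v)]"
proof -
  note next_Grid = snake_next_Grid[OF v(1,2)]
  have sub: "snake_upto v \<subseteq> Grid" by (rule snake_upto_subset[OF v(1)])
  obtain i j where ij: "v = (i, j)" by (cases v)
  have hd: "hd (map f q) = f v" using q by (simp add: hd_map)
  have cand: "(f v, f x) \<in> set ds \<and> f x \<notin> set (map f q) \<longleftrightarrow> grid_adj v x \<and> x \<notin> snake_upto v"
    if "x \<in> Grid" for x
    using adj_iff[OF v(1) that] mem_image[OF that sub] q by simp
  have hug: "(\<exists>z\<in>set (map f q). z \<noteq> f v \<and> (z, f x) \<in> set ds) \<longleftrightarrow>
      (\<exists>z\<in>snake_upto v. z \<noteq> v \<and> grid_adj z x)" if "x \<in> Grid" for x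
  proof -
    have "(\<exists>z\<in>set (map f q). z \<noteq> f v \<and> (z, f x) \<in> set ds) \<longleftrightarrow>
      (\<exists>z\<in>snake_upto v. f z \<noteq> f v \<and> (f z, f x) \<in> set ds)" using q(3) by simp
    also have "\<dots> \<longleftrightarrow> (\<exists>z\<in>snake_upto v. z \<noteq> v \<and> grid_adj z x)"
      by (rule bex_cong[OF refl]) (use adj_iff[OF _ that] inj[OF _ v(1)] sub in blast)
    finally show ?thesis .
  qed
  have next_cand: "(f v, f (snake_next v)) \<in> set ds \<and> f (snake_next v) \<notin> set (map f q)"
    using cand[OF next_Grid] grid_adj_snake_next snake_next_notin v(1) by blast
  have cases: "x = snake_next v \<or> x = (i, Suc j)"
    if "x \<in> Grid" "(f v, f x) \<in> set ds" "f x \<notin> set (map f q)" for x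
    using unvisited_neighbour[OF v(1) that(1)] cand[OF that(1)] that ij by auto
  have next_vs: "f (snake_next v) \<in> set vs" using next_Grid set_vs by simp
  consider (turn) "snake_next v = (i, Suc j)" | (column) "snake_next v \<noteq> (i, Suc j)" "j > 0"
    | (first) "snake_next v \<noteq> (i, Suc j)" "j = 0" by blast
  then show ?thesis
  proof cases
    case turn
    then have only: "w = f (snake_next v)" if "w \<in> set vs" "(f v, w) \<in> set ds" "w \<notin> set (map f q)" for w
      using cases that by (auto simp: set_vs)
    have base: "pick (\<lambda>w. (f v, w) \<in> set ds \<and> w \<notin> set (map f q)) vs [] = [f (snake_next v)]"
      by (rule pick_unique[OF next_vs]) (use next_cand only in blast)+
    have keep: "pick P vs [f (snake_next v)] = [f (snake_next v)]"
      if "\<And>w. P w \<Longrightarrow> (f v, w) \<in> set ds \<and> w \<notin> set (map f q)" for P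
      using pick_cases[of P vs "[f (snake_next v)]"] only that by blast
    show ?thesis unfolding path_choice_def hd base by (subst keep, blast, rule keep, blast)
  next
    case column
    have next_hug: "\<exists>z\<in>snake_upto v. z \<noteq> v \<and> grid_adj z (snake_next v)"
      using v column ij
      by (intro bexI[of _ "(fst (snake_next v), j - 1)"])
        (auto simp: snake_next.simps snake_upto.simps grid_adj_def split: if_splits)
    have right: "\<not> (\<exists>z\<in>snake_upto v. z \<noteq> v \<and> grid_adj z (i, Suc j))"
      using v ij by (auto simp: snake_upto.simps grid_adj_def)
    show ?thesis unfolding path_choice_def hd
    proof (rule pick_unique[OF next_vs])
      show "w = f (snake_next v)" if "w \<in> set vs"
        "(f v, w) \<in> set ds \<and> w \<notin> set (map f q) \<and> (\<exists>z\<in>set (map f q). z \<noteq> f v \<and> (z, w) \<in> set ds)" for w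
      proof -
        obtain x where x: "x \<in> Grid" "w = f x" using \<open>w \<in> set vs\<close> set_vs by auto
        show ?thesis using cases[OF x(1)] hug[OF x(1)] right that(2) x by auto
      qed
    qed (use next_cand hug[OF next_Grid] next_hug in auto)
  next
    case first
    then have i: "Suc i < n" "i > 0" "snake_next v = (Suc i, 0)"
      using v ij by (auto simp: snake_next.simps split: if_splits)
    have no_hug: "\<not> (\<exists>z\<in>snake_upto v. z \<noteq> v \<and> grid_adj z x)" if "x \<in> {(Suc i, 0), (i, 1)}" for x
      using that v ij first by (auto simp: snake_upto.simps grid_adj_def)
    have "card {q \<in> Grid. grid_adj (Suc i, 0) q} \<le> card {(i, 0), (Suc (Suc i), 0), (Suc i, 1::nat)}"
      by (intro card_mono) (auto simp: grid_adj_def)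
    then have low: "length (filter (\<lambda>z. (f (snake_next v), z) \<in> set ds) vs) \<le> 3"
      using degree[OF next_Grid] i(3) card_le_3[of "(i, 0)" "(Suc (Suc i), 0)" "(Suc i, 1::nat)"] by simp
    \<comment> \<open>All four neighbours of \<open>(i, 1)\<close> lie in the grid because
      \<open>0 < i\<close>, \<open>Suc i < n\<close> and \<open>m \<ge> 3\<close>.\<close>
    have "card {(i - 1, 1), (Suc i, 1), (i, 0), (i, 2::nat)} \<le> card {q \<in> Grid. grid_adj (i, 1) q}"
      using i m by (intro card_mono) (auto simp: grid_adj_def)
    moreover have "card {(i - 1, 1), (Suc i, 1), (i, 0), (i, 2::nat)} = 4"
      using i by (auto simp: card_insert_if)
    ultimately have high: "\<not> length (filter (\<lambda>z. (f (i, 1), z) \<in> set ds) vs) \<le> 3"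
      using degree[of "(i, 1)"] i m by simp
    have 1: "\<not> ((f v, w) \<in> set ds \<and> w \<notin> set (map f q) \<and> (\<exists>z\<in>set (map f q). z \<noteq> f v \<and> (z, w) \<in> set ds))"
      if "w \<in> set vs" for w
    proof -
      obtain x where x: "x \<in> Grid" "w = f x" using \<open>w \<in> set vs\<close> set_vs by auto
      show ?thesis using cases[OF x(1)] hug[OF x(1)] no_hug[of x] i(3) first x by auto
    qed
    have 2: "w = f (snake_next v)" if "w \<in> set vs"
      "(f v, w) \<in> set ds \<and> w \<notin> set (map f q) \<and> length (filter (\<lambda>z. (w, z) \<in> set ds) vs) \<le> 3" for w
    proof -
      obtain x where x: "x \<in> Grid" "w = f x" using \<open>w \<in> set vs\<close> set_vs by auto
      show ?thesis using cases[OF x(1)] high first that(2) x by auto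
    qed
    show ?thesis unfolding path_choice_def hd
    proof (subst pick_none[OF 1])
      show "pick (\<lambda>w. (f v, w) \<in> set ds \<and> w \<notin> set (map f q) \<and> length (filter (\<lambda>z. (w, z) \<in> set ds) vs) \<le> 3)
        vs (pick (\<lambda>w. (f v, w) \<in> set ds \<and> w \<notin> set (map f q)) vs []) = [f (snake_next v)]"
        by (rule pick_unique[OF next_vs]) (use next_cand low 2 in blast)+
    qed assumption
  qed
qed

text \<open>Paths have their newest cell in front, so the suffix starting at \<open>v\<close>
  consists of the cells visited up to \<open>v\<close>. Requiring this for all suffixes records the
  visiting order, on which the way back depends.\<close>

definition snake_path :: "(nat \<times> nat) list \<Rightarrow> bool" where
  "snake_path q \<longleftrightarrow> q \<noteq> [] \<and> hd q \<noteq> (0, 0) \<and> set q \<subseteq> Grid \<and> distinct q \<and>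
     (\<forall>xs v ys. q = xs @ v # ys \<longrightarrow> set (v # ys) = snake_upto v)"

lemma snake_path_hd: "snake_path q \<Longrightarrow> set q = snake_upto (hd q) \<and> hd q \<in> Grid"
proof -
  assume q: "snake_path q"
  then obtain v ys where "q = v # ys" by (cases q) (auto simp: snake_path_def)
  moreover from this have "set (v # ys) = snake_upto v" "v \<in> Grid"
    using q unfolding snake_path_def by (blast intro: append_Nil[symmetric], auto)
  ultimately show ?thesis by simp
qed

lemma path_step_snake:
  assumes "n \<ge> 3" "m \<ge> 3" "snake_path q"
  shows "set q = Grid \<and> path_step vs (set ds) (map f q) = map f q \<or>
    path_step vs (set ds) (map f q) = map f (snake_next (hd q) # q) \<and> snake_path (snake_next (hd q) # q)"
proof (cases "snake_end (hd q)")
  case True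
  then have q: "set q = Grid" using snake_path_hd[OF assms(3)] snake_end_upto by blast
  then have "set (map f q) = set vs" using set_vs by simp
  then have "path_choice vs (set ds) (map f q) = []"
    unfolding path_choice_def by (intro trans[OF pick_none]) auto
  then show ?thesis using q by (simp add: path_step_def)
next
  case False
  let ?v = "hd q"
  have v: "?v \<in> Grid" "set q = snake_upto ?v" "?v \<noteq> (0, 0)" "q \<noteq> []"
    using snake_path_hd[OF assms(3)] assms(3) by (auto simp: snake_path_def)
  have "path_choice vs (set ds) (map f q) = [f (snake_next ?v)]"
    using path_choice_snake[OF assms(1,2) v(1) False v(3,4)] v by simp
  then have "path_step vs (set ds) (map f q) = map f (snake_next ?v # q)"
    by (simp add: path_step_def)
  moreover have "snake_path (snake_next ?v # q)"
    unfolding snake_path_def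
  proof (intro conjI allI impI)
    show "set (w # ys) = snake_upto w" if "snake_next ?v # q = xs @ w # ys" for xs w ys
    proof (cases xs)
      case Nil
      then show ?thesis using that v snake_upto_next[OF v(1)] by auto
    next
      case (Cons x xs')
      then have "q = xs' @ w # ys" using that by simp
      then show ?thesis using assms(3) unfolding snake_path_def by blast
    qed
    show "set (snake_next ?v # q) \<subseteq> Grid"
      using snake_next_Grid[OF v(1) False] assms(3) by (auto simp: snake_path_def)
    show "distinct (snake_next ?v # q)"
      using snake_next_notin[OF v(1)] v assms(3) by (auto simp: snake_path_def)
    show "hd (snake_next ?v # q) \<noteq> (0, 0)"
      by (cases ?v) (use v in \<open>auto simp: snake_next.simps odd_pos split: if_splits\<close>)
  qed simp
  ultimately show ?thesis by blast
qed

lemma greedy_path_snake: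
  assumes "n \<ge> 3" "m \<ge> 3"
  obtains q where "greedy_path vs (set ds) (f (0, 0)) (f (1, 0)) = map f q" "snake_path q" "set q = Grid"
proof -
  \<comment> \<open>Until the grid is exhausted every round adds a new cell; after
    \<open>n * m\<close> rounds more than \<open>n * m\<close> distinct cells would be needed
    otherwise.\<close>
  have "\<exists>q. (path_step vs (set ds) ^^ k) [f (1, 0), f (0, 0)] = map f q \<and> snake_path q \<and>
    (set q = Grid \<or> k < length q)" for k
  proof (induction k)
    case 0
    have "snake_path [(1, 0), (0, 0)]"
      using assms by (auto simp: snake_path_def snake_upto.simps Cons_eq_append_conv)
    then show ?case by (intro exI[of _ "[(1, 0), (0, 0)]"]) simp
  next
    case (Suc k)
    then obtain q where q: "(path_step vs (set ds) ^^ k) [f (1, 0), f (0, 0)] = map f q" "snake_path q"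
      "set q = Grid \<or> k < length q" by blast
    from path_step_snake[OF assms q(2)] show ?case
    proof (elim disjE conjE)
      assume "set q = Grid" "path_step vs (set ds) (map f q) = map f q"
      then show ?thesis using q by (intro exI[of _ q]) simp
    next
      assume *: "path_step vs (set ds) (map f q) = map f (snake_next (hd q) # q)"
        "snake_path (snake_next (hd q) # q)"
      then have "set (snake_next (hd q) # q) \<subseteq> Grid" "snake_next (hd q) \<notin> set q"
        by (auto simp: snake_path_def)
      then show ?thesis using q * by (intro exI[of _ "snake_next (hd q) # q"]) auto
    qed
  qed
  from this[of "length vs"] obtain q where q:
    "greedy_path vs (set ds) (f (0, 0)) (f (1, 0)) = map f q" "snake_path q"
    "set q = Grid \<or> n * m < length q"
    unfolding greedy_path_def fold_const length_vs by auto
  have "length q = card (set q)" "set q \<subseteq> Grid" using q(2) by (auto simp: snake_path_def distinct_card)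
  then have "length q \<le> n * m" using card_mono[of Grid "set q"] card_Grid by simp
  then show ?thesis using q that by auto
qed

text \<open>For \<open>j > 0\<close> the left neighbour is visited earliest, since all other
  neighbours lie in column \<open>j\<close> or later; in column 0 it is the cell above. Either move
  lowers the coordinate sum by one. In the stored path \<open>ys\<close> holds the cells visited
  before \<open>t\<close>, and none of them is adjacent to \<open>x\<close>, so the last match is
  \<open>t\<close>.\<close>

lemma back_step_snake:
  assumes q: "snake_path q" "set q = Grid" and x: "x \<in> Grid" "x \<noteq> (0, 0)" and r: "hd r = f x"
  obtains t where "back_step (set ds) (map f q) (f (0, 0)) r = f t # r" "t \<in> Grid"
    "fst t + snd t + 1 = fst x + snd x"
proof -
  obtain i j where ij: "x = (i, j)" by (cases x)
  define t where "t = (if j > 0 then (i, j - 1) else (i - 1, 0))"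
  have t: "t \<in> Grid" "grid_adj t x" "fst t + snd t + 1 = fst x + snd x"
    using x ij by (auto simp: t_def grid_adj_def)
  obtain xs ys where q': "q = xs @ t # ys" using t(1) q(2) split_list by metis
  then have "set (t # ys) = snake_upto t" "t \<notin> set ys"
    using q(1) unfolding snake_path_def by (blast, auto)
  then have not_adj: "\<not> grid_adj y x" and y_Grid: "y \<in> Grid" if "y \<in> set ys" for y
  proof -
    show "y \<in> Grid" using that q' q(2) by auto
    have "y \<in> snake_upto t" "y \<noteq> t" using that \<open>set (t # ys) = _\<close> \<open>t \<notin> _\<close> by auto
    then show "\<not> grid_adj y x" using ij x
      by (cases y) (auto simp: t_def snake_upto.simps grid_adj_def split: if_splits)
  qed
  have "pick (\<lambda>w. (w, f x) \<in> set ds) (map f xs @ f t # map f ys) [] = [f t]"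
  proof (intro pick_last)
    show "(f t, f x) \<in> set ds" using adj_iff[OF t(1) x(1)] t(2) by simp
    show "(w, f x) \<notin> set ds" if w: "w \<in> set (map f ys)" for w
    proof -
      obtain y where "y \<in> set ys" "w = f y" using w by auto
      then show ?thesis using y_Grid not_adj
          adj_iff[OF _ x(1)] by blast
    qed
  qed
  moreover have "f x \<noteq> f (0, 0)" using inj[OF x(1), of "(0, 0)"] x pos by auto
  ultimately have "back_step (set ds) (map f q) (f (0, 0)) r = f t # r"
    using r q' by (simp add: back_step_def)
  then show ?thesis using t that by blast
qed

lemma close_path_snake:
  assumes q: "snake_path q" "set q = Grid"
  defines "r \<equiv> close_path vs (set ds) (f (0, 0)) (map f q)"
  shows "set (map f q) \<subseteq> set r" "length r \<le> n * m + n + m"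
proof -
  let ?s = "back_step (set ds) (map f q) (f (0, 0))"
  define s where "s = fst (hd q) + snd (hd q)"
  have hdq: "hd q \<in> Grid" "q \<noteq> []" using snake_path_hd[OF q(1)] q by (auto simp: snake_path_def)
  \<comment> \<open>The length plus the coordinate sum of the current cell never exceeds its initial
    value, and the sum falls in each round until the corner is reached. The way back thus costs at
    most \<open>s\<close> steps.\<close>
  have "\<exists>x\<in>Grid. hd ((?s ^^ k) (map f q)) = f x \<and> set (map f q) \<subseteq> set ((?s ^^ k) (map f q)) \<and>
    length ((?s ^^ k) (map f q)) + fst x + snd x \<le> length q + s \<and> (x = (0, 0) \<or> fst x + snd x + k \<le> s)" for k
  proof (induction k)
    case 0
    show ?case using hdq by (intro bexI[of _ "hd q"]) (auto simp: s_def hd_map)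
  next
    case (Suc k)
    define r where "r = (?s ^^ k) (map f q)"
    obtain x where x: "x \<in> Grid" "hd r = f x" "set (map f q) \<subseteq> set r" "length r + fst x + snd x \<le> length q + s"
      "x = (0, 0) \<or> fst x + snd x + k \<le> s" using Suc unfolding r_def by blast
    show ?case
    proof (cases "x = (0, 0)")
      case True
      then have "?s r = r" using x by (simp add: back_step_def)
      then show ?thesis using x True by (intro bexI[of _ x]) (auto simp: r_def[symmetric])
    next
      case False
      obtain t where "?s r = f t # r" "t \<in> Grid" "fst t + snd t + 1 = fst x + snd x"
        using back_step_snake[OF q x(1) False x(2)] by blast
      then show ?thesis using x False by (intro bexI[of _ t]) (auto simp: r_def[symmetric])
    qed
  qed
  from this[of "n * m"] obtain x where x: "x \<in> Grid" "hd ((?s ^^ (n * m)) (map f q)) = f x"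
    "set (map f q) \<subseteq> set ((?s ^^ (n * m)) (map f q))"
    "length ((?s ^^ (n * m)) (map f q)) + fst x + snd x \<le> length q + s"
    "x = (0, 0) \<or> fst x + snd x + n * m \<le> s" by blast
  have s: "s + 2 \<le> n + m" using hdq(1) by (cases "hd q") (auto simp: s_def)
  \<comment> \<open>This is \<open>(n - 1) * (m - 1) \<ge> 0\<close>. It gives
    \<open>s < n * m\<close>, so the clock of \<open>n * m\<close> rounds suffices for the way
    back.\<close>
  have "n + m \<le> n * m + 1"
  proof -
    obtain n' m' where "n = Suc n'" "m = Suc m'" using pos by (cases n; cases m) auto
    then show ?thesis by simp
  qed
  then have "x = (0, 0)" using x(5) s by linarith
  then have "r = (?s ^^ (n * m)) (map f q)"
    using x(2) by (simp add: r_def close_path_def fold_const length_vs)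
  moreover have "length q = n * m"
    using q distinct_card[of q] card_Grid by (simp add: snake_path_def)
  ultimately show "set (map f q) \<subseteq> set r" "length r \<le> n * m + n + m" using x s by auto
qed

text \<open>The closed snake already visits every vertex, so no detour is added. The bound is on the
  list, which is one longer than the walk.\<close>

lemma candidate_snake:
  assumes "n \<ge> 3" "m \<ge> 3"
  shows "length (candidate vs ds xs (f (0, 0), f (1, 0))) \<le> n * m + n + m"
proof -
  obtain q where q: "greedy_path vs (set ds) (f (0, 0)) (f (1, 0)) = map f q" "snake_path q" "set q = Grid"
    using greedy_path_snake[OF assms] by blast
  define r where "r = close_path vs (set ds) (f (0, 0)) (map f q)"
  have "(f (0, 0), f (1, 0)) \<in> set ds" "f (0, 0) \<noteq> f (1, 0)"
    using adj_iff[of "(0, 0)" "(1, 0)"] inj[of "(0, 0)" "(1, 0)"] assms by (auto simp: grid_adj_def)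
  from greedy_path_walk[OF this] have "closed r"
    using close_path_walk[of "map f q" "f (0, 0)"] q(1) by (auto simp: r_def closed_def)
  moreover have "set r = set vs"
    using close_path_snake(1)[OF q(2,3)] \<open>closed r\<close> set_vs q(3) by (auto simp: r_def closed_def is_walk_def)
  ultimately have "complete_walk vs ds r = r" by (rule complete_walk_idle)
  then show ?thesis
    using close_path_snake(2)[OF q(2,3)] assms 
    unfolding candidate_def fst_conv snd_conv q(1) r_def[symmetric] by simp
qed

end

section \<open>Lower bound\<close>

lemma card_incident_walk:
  assumes "finite E" "\<And>v. v \<in> set p \<Longrightarrow> card {e \<in> E. v \<in> e} \<le> 4"
    and "p \<noteq> []" "successively (\<lambda>a b. {a, b} \<in> E) p"
  shows "card {e \<in> E. \<exists>v\<in>set p. v \<in> e} \<le> 3 * walk_length p + 4"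
  using assms(2-)
proof (induction p)
  case (Cons x p)
  show ?case
  proof (cases p)
    case Nil
    then show ?thesis using Cons.prems(1) by (simp add: walk_length_def)
  next
    case (Cons y ys)
    let ?I = "{e \<in> E. \<exists>v\<in>set p. v \<in> e}" and ?J = "{e \<in> E. x \<in> e}"
    have "card {e \<in> E. \<exists>v\<in>set (x # p). v \<in> e} \<le> card (?I \<union> (?J - {{x, y}}))"
      using Cons assms(1) by (intro card_mono) auto
    also have "\<dots> \<le> card ?I + card (?J - {{x, y}})" by (rule card_Un_le)
    also have "card (?J - {{x, y}}) \<le> 3"
      using Cons Cons.prems(1)[of x] Cons.prems(3) assms(1) by (simp add: card_Diff_singleton)
    also have "card ?I \<le> 3 * walk_length p + 4"
      using Cons Cons.prems by (intro Cons.IH) auto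
    finally show ?thesis using Cons by (simp add: walk_length_def)
  qed
qed simp

lemma successively_iff_nth:
  "successively P xs \<longleftrightarrow> (\<forall>i. Suc i < length xs \<longrightarrow> P (xs ! i) (xs ! Suc i))"
proof (induction xs rule: induct_list012)
  case (3 x y zs)
  then show ?case by (auto simp: nth_Cons split: nat.splits)
qed auto

section \<open>Counting the edges of a grid\<close>

lemma verts_path_graph: "verts (path_graph n) = {..<n}"
  by (simp add: path_graph_def)

lemma edges_grid:
  "edges (cartesian_product (path_graph n) (path_graph m)) =
    {{p, q} | p q. p \<in> {..<n} \<times> {..<m} \<and> q \<in> {..<n} \<times> {..<m} \<and> grid_adj p q}"
  (is "?L = ?R")
proof
  show "?L \<subseteq> ?R"
  proof
    fix e assume "e \<in> ?L"
    then consider u v v' where "e = {(u, v), (u, v')}" "u < n" "{v, v'} \<in> edges (path_graph m)"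
      | u u' v where "e = {(u, v), (u', v)}" "{u, u'} \<in> edges (path_graph n)" "v < m"
      unfolding cartesian_product_def by (simp add: verts_path_graph) blast
    then show "e \<in> ?R"
    proof cases
      case 1
      then have "grid_adj (u, v) (u, v')" "v < m" "v' < m"
        by (auto simp: path_graph_def grid_adj_def doubleton_eq_iff)
      then show ?thesis using 1 by blast
    next
      case 2
      then have "grid_adj (u, v) (u', v)" "u < n" "u' < n"
        by (auto simp: path_graph_def grid_adj_def doubleton_eq_iff)
      then show ?thesis using 2 by blast
    qed
  qed
  show "?R \<subseteq> ?L"
  proof
    fix e assume "e \<in> ?R"
    then obtain p q where e: "e = {p, q}" and pq: "p \<in> {..<n} \<times> {..<m}" "q \<in> {..<n} \<times> {..<m}" "grid_adj p q"
      by blast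
    obtain i j k l where [simp]: "p = (i, j)" "q = (k, l)" by (cases p; cases q)
    consider "i = k" "{j, l} \<in> edges (path_graph m)" | "j = l" "{i, k} \<in> edges (path_graph n)"
      using pq by (auto simp: path_graph_def grid_adj_def doubleton_eq_iff)
    then show "e \<in> ?L"
    proof cases
      case 1
      then have "\<exists>u v v'. e = {(u, v), (u, v')} \<and> u < n \<and> {v, v'} \<in> edges (path_graph m)"
        using pq by (intro exI[of _ i] exI[of _ j] exI[of _ l]) (simp add: e)
      then show ?thesis unfolding cartesian_product_def by (simp add: verts_path_graph)
    next
      case 2
      then have "\<exists>u u' v. e = {(u, v), (u', v)} \<and> {u, u'} \<in> edges (path_graph n) \<and> v < m"
        using pq by (intro exI[of _ i] exI[of _ k] exI[of _ j]) (simp add: e)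
      then show ?thesis unfolding cartesian_product_def by (simp add: verts_path_graph)
    qed
  qed
qed

text \<open>The \<open>n * (m - 1)\<close> edges within rows and the \<open>(n - 1) * m\<close>
  edges within columns are disjoint families. Moving \<open>n + m\<close> to the right avoids
  truncated subtraction.\<close>

lemma card_grid_edges:
  assumes "n \<ge> 1" "m \<ge> 1"
  shows "2 * (n * m) \<le> card (edges (cartesian_product (path_graph n) (path_graph m))) + n + m"
proof -
  let ?E = "edges (cartesian_product (path_graph n) (path_graph m))"
  let ?h = "\<lambda>(i, j). {(i, j), (i, Suc j)}" and ?v = "\<lambda>(i, j). {(i, j), (Suc i, j)}"
  let ?H = "?h ` ({..<n} \<times> {..<m - 1})" and ?V = "?v ` ({..<n - 1} \<times> {..<m})"
  have card_H: "card ?H = n * (m - 1)"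
    by (subst card_image) (auto simp: inj_on_def doubleton_eq_iff)
  have card_V: "card ?V = (n - 1) * m"
    by (subst card_image) (auto simp: inj_on_def doubleton_eq_iff)
  have card_Un: "card (?H \<union> ?V) = card ?H + card ?V"
    by (rule card_Un_disjoint) (auto simp: doubleton_eq_iff)
  have "finite ?E"
  proof (rule finite_subset)
    show "?E \<subseteq> Pow ({..<n} \<times> {..<m})" unfolding edges_grid by blast
  qed simp
  have "?H \<union> ?V \<subseteq> ?E"
  proof -
    have "{(i, j), (i, Suc j)} \<in> ?E" if "i < n" "j < m - 1" for i j
      unfolding edges_grid mem_Collect_eq
      by (intro exI[of _ "(i, j)"] exI[of _ "(i, Suc j)"]) (use that in \<open>auto simp: grid_adj_def\<close>)
    moreover have "{(i, j), (Suc i, j)} \<in> ?E" if "i < n - 1" "j < m" for i j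
      unfolding edges_grid mem_Collect_eq
      by (intro exI[of _ "(i, j)"] exI[of _ "(Suc i, j)"]) (use that in \<open>auto simp: grid_adj_def\<close>)
    ultimately show ?thesis by auto
  qed
  then have "card (?H \<union> ?V) \<le> card ?E" by (rule card_mono[OF \<open>finite ?E\<close>])
  then have "n * (m - 1) + (n - 1) * m \<le> card ?E" unfolding card_Un card_H card_V .
  moreover obtain n' m' where "n = Suc n'" "m = Suc m'" using assms by (cases n; cases m) auto
  ultimately show ?thesis by simp
qed

text \<open>Here \<open>e\<close> stands for the number of edges, \<open>x\<close> for
  \<open>card X\<close>, \<open>k\<close> for the number of remaining edges and \<open>L\<close> for
  the output length. For \<open>opt > 0\<close> the right-hand side has \<open>B \<ge> 1\<close>;
  for \<open>opt = 0\<close> it may vanish, so \<open>L = 0\<close> is required.\<close>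

lemma approximation_arith:
  fixes n m e x k opt L :: nat
  assumes n: "n \<ge> 1" "m \<ge> 1" and e: "2 * (n * m) \<le> e + n + m" "x + k = e"
    and x: "x \<le> 3 * opt + 4" and L: "L \<le> 4 * (n * m) + 1"
    and big: "n \<ge> 3 \<Longrightarrow> m \<ge> 3 \<Longrightarrow> L \<le> n * m + n + m" and zero: "opt = 0 \<Longrightarrow> L = 0"
  shows "real L \<le> (3 / 2 + 66 * (1 / real n + 1 / real m)) * (real opt + real k)"
proof -
  define B where "B = real opt + real k"
  define S where "S = 1 / real n + 1 / real m"
  have S0: "S \<ge> 0" by (simp add: S_def)
  have B0: "B \<ge> 0" by (simp add: B_def)
  have "e \<le> 3 * (opt + k) + 4" using x e(2) by presburger
  then have "real e \<le> real (3 * (opt + k) + 4)" by (rule of_nat_mono)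
  then have 3: "3 * B \<ge> real e - 4" by (simp add: B_def)
  have "real L \<le> (3 / 2 + 66 * S) * B"
  proof (cases "opt = 0")
    case True
    then show ?thesis using zero S0 B0 by simp
  next
    case False
    then have B1: "B \<ge> 1" by (simp add: B_def)
    show ?thesis
    proof (cases "n \<ge> 3 \<and> m \<ge> 3")
      case True
      then have nm: "real n * 3 \<le> real (n * m)" "real m * 3 \<le> real (n * m)" by simp_all
      have "real (n * m) \<ge> 9"
        using of_nat_mono[OF mult_le_mono[of 3 n 3 m], where 'a = real] True by simp
      have "2 * real (n * m) \<le> real e + real n + real m"
        using of_nat_mono[OF e(1), where 'a = real] by simp
      \<comment> \<open>For \<open>n, m \<ge> 3\<close> one has
        \<open>n + m \<le> 2/3 * n * m\<close> and \<open>4 \<le> 4/9 * n * m\<close>, so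
        \<open>3 * B \<ge> (2 - 2/3 - 4/9) * n * m = 8/9 * n * m\<close>.\<close>
      then have B: "B \<ge> 8 / 27 * real (n * m)" and B': "3 * B \<ge> 2 * real (n * m) - real n - real m - 4"
        using 3 nm \<open>real (n * m) \<ge> 9\<close> by linarith+
      have "S * real (n * m) = real n + real m" using n by (simp add: S_def field_simps)
      have "S * B \<ge> S * (8 / 27 * real (n * m))" using B S0 by (rule mult_left_mono)
      then have "S * B \<ge> 8 / 27 * (real n + real m)"
        using \<open>S * real (n * m) = _\<close> by (simp add: mult.left_commute)
      moreover have "real L \<le> real (n * m) + real n + real m"
        using of_nat_mono[of L "n * m + n + m", where 'a = real] big True by simp
      moreover have "real n + real m \<ge> 6" using True by linarith
      \<comment> \<open>By \<open>B'\<close>, \<open>L\<close> exceeds \<open>3/2 * B\<close> by at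
        most \<open>3/2 * (n + m) + 2\<close>, while \<open>66 * S * B\<close> is at least
        \<open>66 * 8/27 * (n + m)\<close>, more than 19 times \<open>n + m\<close>.\<close>
      ultimately show ?thesis using B' by (simp add: algebra_simps)
    next
      case False
      then have "n \<le> 2 \<or> m \<le> 2" by auto
      \<comment> \<open>In a narrow grid \<open>66 * S \<ge> 33\<close>, so it is enough to bound
        \<open>L\<close> by \<open>33 * B\<close>.\<close>
      then have "S \<ge> 1 / 2"
      proof
        assume "n \<le> 2"
        then have "1 / real n \<ge> 1 / 2" using n by (simp add: field_simps)
        then show ?thesis unfolding S_def by (simp add: add_increasing2)
      next
        assume "m \<le> 2"
        then have "1 / real m \<ge> 1 / 2" using n by (simp add: field_simps)
        then show ?thesis unfolding S_def by (simp add: add_increasing)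
      qed
      then have "1 / 2 * B \<le> S * B" using B0 by (rule mult_right_mono)
      moreover have "n + m \<le> n * m + 1"
      proof -
        obtain n' m' where "n = Suc n'" "m = Suc m'" using n by (cases n; cases m) auto
        then show ?thesis by simp
      qed
      then have "n * m \<le> e + 1" using e(1) by linarith
      then have "L \<le> 4 * e + 5" using L by linarith
      then have "real L \<le> 4 * real e + 5" using of_nat_mono[of L "4 * e + 5", where 'a = real] by simp
      \<comment> \<open>From \<open>e \<le> 3 * B + 4\<close> and \<open>B \<ge> 1\<close>:
        \<open>4 * e + 5 \<le> 12 * B + 21 \<le> 33 * B\<close>.\<close>
      then have "real L \<le> 33 * B" using 3 B1 by linarith
      ultimately show ?thesis using B0 by (simp add: algebra_simps)
    qed
  qed
  then show ?thesis by (simp add: B_def S_def)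
qed

context labelled_grid
begin

lemma card_neighbours: "card {q \<in> Grid. grid_adj p q} \<le> 4"
proof -
  obtain i j where p: "p = (i, j)" by (cases p)
  \<comment> \<open>At the border the truncated \<open>i - 1\<close> or \<open>j - 1\<close> merely
    lists \<open>p\<close> itself, which is harmless for an upper bound.\<close>
  have "card {q \<in> Grid. grid_adj p q} \<le> card {(Suc i, j), (i - 1, j), (i, Suc j), (i, j - 1)}"
    unfolding p by (intro card_mono) (auto simp: grid_adj_def)
  also have "\<dots> \<le> 4" by (simp add: card_insert_if)
  finally show ?thesis .
qed

lemma card_incident:
  assumes "v \<in> set vs"
  shows "card {e \<in> {{f p, f q} | p q. p \<in> Grid \<and> q \<in> Grid \<and> grid_adj p q}. v \<in> e} \<le> 4"
    (is "card ?I \<le> 4")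
proof -
  obtain p where p: "p \<in> Grid" "v = f p" using assms set_vs by auto
  have "?I \<subseteq> (\<lambda>q. {f p, f q}) ` {q \<in> Grid. grid_adj p q}"
  proof
    fix e assume "e \<in> ?I"
    then obtain a b where ab: "e = {f a, f b}" "a \<in> Grid" "b \<in> Grid" "grid_adj a b" by blast
    have "f p \<in> e" using \<open>e \<in> ?I\<close> p(2) by simp
    then have "p = a \<or> p = b" using ab inj[OF p(1)] by simp
    then show "e \<in> (\<lambda>q. {f p, f q}) ` {q \<in> Grid. grid_adj p q}"
    proof
      assume "p = a"
      then show ?thesis using ab by blast
    next
      assume "p = b"
      then have "e = {f p, f a}" "grid_adj p a" using ab grid_adj_sym by auto
      then show ?thesis using ab(2) by blast
    qed
  qed
  then have "card ?I \<le> card ((\<lambda>q. {f p, f q}) ` {q \<in> Grid. grid_adj p q})"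
    by (intro card_mono) auto
  also have "\<dots> \<le> card {q \<in> Grid. grid_adj p q}" by (rule card_image_le) simp
  finally show ?thesis using card_neighbours[of p] by simp
qed

end

section \<open>The guarantee for an arbitrarily labelled grid\<close>

lemma best_candidate_star:
  assumes star: "star_instance G X" and grid: "grid_graph n m G"
    and vs: "distinct vs" "set vs = verts G"
    and es: "lists_edges es (edges G)" and xs: "lists_edges xs X"
  defines "p \<equiv> best_candidate vs (darts es) xs"
  shows "closed_walk G p" "covers p X"
    "real (walk_length p) \<le> (3 / 2 + 66 * (1 / real n + 1 / real m)) *
      (real (OPT G X) + real (card (edges G - X)))"
proof -
  define Gr where "Gr = {..<n} \<times> {..<m}"
  let ?P = "cartesian_product (path_graph n) (path_graph m)"
  have pos: "n \<ge> 1" "m \<ge> 1" using grid by (auto simp: grid_graph_def)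
  have "verts ?P = Gr" by (simp add: cartesian_product_def path_graph_def Gr_def)
  then obtain f where f: "bij_betw f Gr (verts G)" and "edges G = (\<lambda>e. f ` e) ` edges ?P"
    using grid by (auto simp: grid_graph_def graph_iso_def)
  then have E_image: "edges G = (\<lambda>e. f ` e) ` {{p, q} | p q. p \<in> Gr \<and> q \<in> Gr \<and> grid_adj p q}"
    and E_P: "edges G = (\<lambda>e. f ` e) ` edges ?P"
    unfolding edges_grid Gr_def by simp_all
  have E: "edges G = {{f p, f q} | p q. p \<in> Gr \<and> q \<in> Gr \<and> grid_adj p q}"
    unfolding E_image by (auto simp: image_iff) (metis image_empty image_insert)+
  have ds: "(a, b) \<in> set (darts es) \<longleftrightarrow> {a, b} \<in> edges G" for a b
  proof -
    have "edges G = (\<lambda>(u, v). {u, v}) ` set es" using es by (simp add: lists_edges_def)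
    then have "{a, b} \<in> edges G \<longleftrightarrow> (\<exists>(u, v)\<in>set es. {a, b} = {u, v})"
      by (auto simp: image_iff split_beta)
    also have "\<dots> \<longleftrightarrow> (a, b) \<in> set (darts es)"
      by (force simp: set_darts doubleton_eq_iff)
    finally show ?thesis by simp
  qed
  have set_ds: "set (darts es) = {(f p, f q) | p q. p \<in> Gr \<and> q \<in> Gr \<and> grid_adj p q}"
  proof -
    have "(a, b) \<in> set (darts es) \<longleftrightarrow> (\<exists>p q. (a, b) = (f p, f q) \<and> p \<in> Gr \<and> q \<in> Gr \<and> grid_adj p q)" for a b
      unfolding ds E using grid_adj_sym by (auto simp: doubleton_eq_iff) blast+
    then show ?thesis by (intro set_eqI) (simp only: mem_Collect_eq split_paired_all)
  qed
  interpret labelled_grid n m f vs "darts es"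
    by (rule labelled_grid.intro[OF pos _ vs(1) set_ds[unfolded Gr_def]]) (use f vs(2) in \<open>simp add: Gr_def\<close>)
  have Gr: "Gr = Grid" by (simp add: Gr_def Grid_def)
  have X: "X \<subseteq> edges G" "X \<noteq> {}" and simple: "simple_graph G" using star by (auto simp: star_instance_def)
  have X_xs: "X = (\<lambda>(u, v). {u, v}) ` set xs" using xs by (auto simp: lists_edges_def)
  have edge: "\<exists>u v. e = {u, v} \<and> u \<in> verts G \<and> v \<in> verts G \<and> u \<noteq> v" if "e \<in> edges G" for e
    using simple that unfolding simple_graph_def by blast
  have loop: "fst e \<noteq> snd e" if "e \<in> set (darts es)" for e
  proof -
    have "{fst e, snd e} \<in> edges G" using ds[of "fst e" "snd e"] that by simp
    from edge[OF this] show ?thesis by (auto simp: doubleton_eq_iff)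
  qed
  have ne: "darts es \<noteq> []"
  proof -
    obtain e where "e \<in> edges G" using X by blast
    then show ?thesis using edge[of e] ds by fastforce
  qed
  have cand: "candidate vs (darts es) xs e \<noteq> []" if "e \<in> set (darts es)" for e
    using candidate_closed(1)[OF that loop[OF that], of xs] by (simp add: closed_def is_walk_def)
  note best = best_candidate[OF ne cand, folded p_def]
  obtain e where e: "e \<in> set (darts es)" "p = candidate vs (darts es) xs e" using best(1) by auto
  note cc = candidate_closed[OF e(1) loop[OF e(1)], of xs, folded e(2)]
  have walk: "closed_walk G p' \<longleftrightarrow> p' \<noteq> [] \<and> set p' \<subseteq> verts G \<and> hd p' = last p' \<and>
    successively (\<lambda>a b. {a, b} \<in> edges G) p'" for p'
    by (simp add: closed_walk_def successively_iff_nth)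
  show cw: "closed_walk G p"
    using cc(1) vs(2) unfolding walk closed_def is_walk_def ds by auto
  show cov: "covers p X"
    using cc(2)
  proof (elim disjE conjE)
    assume "\<forall>x\<in>set xs. fst x = fst e \<or> snd x = fst e" "p = [fst e]"
    then show ?thesis by (auto simp: covers_def X_xs)
  next
    assume "set p = set vs"
    then show ?thesis using edge X(1) vs(2) unfolding covers_def by blast
  qed
  \<comment> \<open>The computed walk \<open>p\<close> is itself a witness that the set minimised by
    \<open>LEAST\<close> is nonempty, so the optimum is attained.\<close>
  have "\<exists>p'. closed_walk G p' \<and> covers p' X \<and> walk_length p' = OPT G X"
    unfolding OPT_def by (rule LeastI[of _ "walk_length p"]) (use cw cov in blast)
  then obtain p' where p': "closed_walk G p'" "covers p' X" "walk_length p' = OPT G X" by blast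
  have fin: "finite (edges G)"
    using edge vs(2)[symmetric] by (intro finite_subset[of "edges G" "Pow (set vs)"]) auto
  have "card X \<le> card {e \<in> edges G. \<exists>v\<in>set p'. v \<in> e}"
    using p'(2) X(1) fin by (intro card_mono) (auto simp: covers_def)
  also have "\<dots> \<le> 3 * walk_length p' + 4"
  proof (rule card_incident_walk[OF fin])
    show "card {e \<in> edges G. v \<in> e} \<le> 4" if "v \<in> set p'" for v
    proof -
      have "v \<in> set vs" using that p'(1) vs(2) by (auto simp: closed_walk_def)
      then show ?thesis using card_incident unfolding E Gr by blast
    qed
  qed (use p'(1) in \<open>simp_all add: walk\<close>)
  finally have card_X: "card X \<le> 3 * OPT G X + 4" by (simp add: p'(3))
  have card_E: "2 * (n * m) \<le> card (edges G) + n + m"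
  proof -
    have "edges ?P \<subseteq> Pow Gr" unfolding edges_grid Gr_def by blast
    then have "card (edges G) = card (edges ?P)"
      unfolding E_P by (intro card_image inj_on_subset[OF inj_on_image_Pow[OF inj_on_Grid[folded Gr]]])
    then show ?thesis using card_grid_edges[OF pos] by simp
  qed
  show "real (walk_length p) \<le> (3 / 2 + 66 * (1 / real n + 1 / real m)) *
      (real (OPT G X) + real (card (edges G - X)))"
  proof (rule approximation_arith[OF pos card_E _ card_X])
    show "card X + card (edges G - X) = card (edges G)"
      using card_mono[OF fin X(1)] finite_subset[OF X(1) fin] by (simp add: card_Diff_subset[OF _ X(1)])
    show "walk_length p \<le> 4 * (n * m) + 1"
      using cc(3) length_vs by (simp add: walk_length_def)
    show "walk_length p \<le> n * m + n + m" if "n \<ge> 3" "m \<ge> 3"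
    proof -
      have "(f (0, 0), f (1, 0)) \<in> set (darts es)"
        using adj_iff[of "(0, 0)" "(1, 0)"] that by (simp add: grid_adj_def)
      from best(2)[OF _ this] candidate_snake[OF that, of xs] show ?thesis
        by (simp add: walk_length_def)
    qed
    show "walk_length p = 0" if "OPT G X = 0"
    proof -
      \<comment> \<open>An optimal walk of length 0 is a single vertex \<open>v\<close> meeting all
        of \<open>X\<close>. As \<open>X\<close> is nonempty, some edge is incident with
        \<open>v\<close>; the candidate started along it is \<open>[v]\<close>, and the chosen
        output is no longer than that.\<close>
      have "length p' = 1" using p' that by (cases p') (auto simp: walk_length_def closed_walk_def)
      then obtain v where v: "p' = [v]" by (cases p') auto
      obtain e0 where e0: "e0 \<in> X" using X(2) by blast
      then have "v \<in> e0" "e0 \<in> edges G" using p'(2) X(1) by (auto simp: covers_def v)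
      then obtain a b where "e0 = {a, b}" using edge by blast
      with \<open>v \<in> e0\<close> have "e0 = {v, b} \<or> e0 = {v, a}" by auto
      then obtain w where "e0 = {v, w}" by blast
      then have vw: "(v, w) \<in> set (darts es)" using e0 X(1) ds by auto
      have "\<forall>x\<in>set xs. fst x = v \<or> snd x = v"
        using p'(2) by (auto simp: covers_def v X_xs)
      then have "candidate vs (darts es) xs (v, w) = [v]" by (auto simp: candidate_def)
      then show ?thesis using best(2)[OF _ vw] by (simp add: walk_length_def)
    qed
  qed
qed

theorem theorem5:
  "\<exists>(P :: com) (c :: real). polynomial_time P \<and> c > 0 \<and>
     (\<forall>(n :: nat) (m :: nat) (G :: nat graph) (X :: nat set set) (d :: data).
        star_instance G X \<and> grid_graph n m G \<and> encodes_instance d G X \<longrightarrow>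
        (\<exists>p. outputs P d (enc_walk p) \<and> closed_walk G p \<and> covers p X \<and>
           real (walk_length p)
             \<le> (3 / 2 + c * (1 / real n + 1 / real m))
                * (real (OPT G X) + real (card (edges G - X)))))"
proof -
  obtain P where P: "polynomial_time P" "\<And>d. outputs P d (dstar d)"
    using polynomial_time_if_ptime[OF ptime_dstar] by blast
  show ?thesis
  proof (intro exI[of _ P] exI[of _ 66] conjI allI impI P(1))
    fix n m :: nat and G :: "nat graph" and X :: "nat set set" and d :: data
    assume *: "star_instance G X \<and> grid_graph n m G \<and> encodes_instance d G X"
    then obtain vs es xs where d: "distinct vs" "set vs = verts G" "lists_edges es (edges G)"
      "lists_edges xs X" "d = Dot (enc_list enc_nat vs) (Dot (enc_edges es) (enc_edges xs))"
      unfolding encodes_instance_def by blast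
    have "outputs P d (enc_walk (best_candidate vs (darts es) xs))"
      using P(2)[of d] unfolding d(5) dstar_enc .
    then show "\<exists>p. outputs P d (enc_walk p) \<and> closed_walk G p \<and> covers p X \<and>
           real (walk_length p) \<le> (3 / 2 + 66 * (1 / real n + 1 / real m))
                * (real (OPT G X) + real (card (edges G - X)))"
      using best_candidate_star[of G X n m vs es xs] * d by blast
  qed simp
qed

end
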